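(* Let $\bar x\in\mathbb{R}^n$, $r>0$, $X=\mathbb{B}(\bar x,r)$, and let $f:X\to\mathbb{R}$ be continuously differentiable with $\|\nabla f(x)-\nabla f(y)\|\le L\|x-y\|$ for all $x,y\in X$, where $L>0$. Let $\bar x$ be a local minimizer of $f$ and let $f$ satisfy the PLK condition at $\bar x$ with a desingularizing function $\psi$. Let $\nu\in(0,1)$ and $\{\beta_k\},\{\gamma_k\}\subset[0,\infty)$ with $\bar\beta=\sup_k\beta_k\in[0,\sqrt{1-\nu})$ and $\bar\delta=\sup_k|\beta_k-\gamma_k|<\infty$. Then there exist $\xi\in(0,r]$ and $T>0$ such that for any initial point $x^0=x^1\in\mathbb{B}(\bar x,\xi)$, any $\tau_1\in(0,T]$ and any $\tau_2\in\big[0,\frac{\nu}{L(\nu+1)}\big]$, the sequence $\{x^k\}$ generated by the extragradient method with momentum (EGm, see context), provided that $\nabla f(x^k_{\rm ex})\ne0$ for all $k\in\mathbb{N}$, has the following properties. (i) The sequences $\{x^k\},\{x^k_{\rm in}\},\{x^k_{\rm ex}\}$ stay in $\mathbb{B}(\bar x,r)$ and converge to some local minimizer $\tilde x\in\mathbb{B}(\bar x,r)$ of $f$ with $f(\tilde x)=f(\bar x)$. (ii) If $\psi(t)=Mt^{1-q}$ for some $M>0$ and $q\in(0,1)$, then as $k\to\infty$: - for $q=1/2$, the sequences $\{x^k\},\{\nabla f(x^k)\},\{f(x^k)\}$ converge linearly to $\tilde x$, $0$, $f(\tilde x)$, respectively; - for $q\in(1/2,1)$, $$\|x^k-\tilde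 x\|=\mathcal{O}\big(k^{-\frac{1-q}{2q-1}}\big),\quad \|\nabla f(x^k)\|=\mathcal{O}\big(k^{-\frac{1-q}{2q-1}}\big),\quad f(x^k)-f(\tilde x)=\mathcal{O}\big(k^{-\frac{2-2q}{2q-1}}\big).$$
   Context: $\|\cdot\|$ is the Euclidean norm, $\mathbb{B}(\bar x,r)$ is the open ball, $\mathbb{N}=\{1,2,\dots\}$. EGm: given $x^0=x^1\in X$, $\{\beta_k\},\{\gamma_k\}\subset[0,\infty)$ with $\bar\beta:=\sup_k\beta_k<1$ and $\bar\delta:=\sup_k|\beta_k-\gamma_k|<\infty$, and stepsizes $\tau_1,\tau_2$, for each $k\ge1$ put $x^k_{\rm in}:=x^k+\beta_k(x^k-x^{k-1})$, $x^k_{\rm ex}:=x^k+\gamma_k(x^k-x^{k-1})$, $x^{k+1}:=x^k_{\rm in}-\tau_1\nabla f\big(x^k_{\rm ex}-\tau_2\nabla f(x^k_{\rm ex})\big)$. Convention: for the recursion to make sense before one knows that its points lie in $X$, $\nabla f$ outside $X$ is understood as an arbitrary fixed extension of $\nabla f$ to $\mathbb{R}^n$. PLK (Polyak-Łojasiewicz-Kurdyka) condition for a $C^1$ function $f$ at $\bar x$ with desingularizing function $\varphi$: there are $\eta\in(0,\infty]$, a neighborhood $U\subset X$ of $\bar x$ and a concave function $\varphi:[0,\eta)\to[0,\infty)$ such that $\varphi(0)=0$, $\varphi$ is $C^1$ on $(0,\eta)$, $\varphi'>0$ on $(0,\eta)$, and $\varphi'(f(x)-f(\bar x))\|\nabla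 f(x)\|\ge1$ for all $x\in U$ with $f(\bar x)<f(x)<f(\bar x)+\eta$. A sequence $\{u^k\}$ converges linearly to $u$ if $\|u^k-u\|=\mathcal{O}(\mu^k)$ for some $\mu\in(0,1)$ (R-linear convergence). *)

theory Defs
  imports "HOL-Analysis.Analysis" "HOL-Library.Landau_Symbols"
begin

definition local_minimizer_on :: "'a::metric_space set \<Rightarrow> ('a \<Rightarrow> real) \<Rightarrow> 'a \<Rightarrow> bool" where
  "local_minimizer_on X f x \<longleftrightarrow>
     x \<in> X \<and> (\<exists>\<epsilon>>0. \<forall>y \<in> X \<inter> ball x \<epsilon>. f x \<le> f y)"

text \<open>A desingularizing function \<open>\<phi> : [0, \<eta>) \<rightarrow> [0, \<infinity>)\<close> with \<open>\<eta> \<in> (0, \<infinity>]\<close>. As a HOL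
  function \<open>\<phi>\<close> is total, but its values outside \<open>[0, \<eta>)\<close> play no role. No continuity at
  \<open>0\<close> is required.\<close>

definition desingularizing :: "ereal \<Rightarrow> (real \<Rightarrow> real) \<Rightarrow> bool" where
  "desingularizing \<eta> \<phi> \<longleftrightarrow>
     0 < \<eta> \<and>
     (\<forall>t. 0 \<le> t \<and> ereal t < \<eta> \<longrightarrow> 0 \<le> \<phi> t) \<and>
     concave_on {t. 0 \<le> t \<and> ereal t < \<eta>} \<phi> \<and>
     \<phi> 0 = 0 \<and>
     (\<forall>t. 0 < t \<and> ereal t < \<eta> \<longrightarrow> (\<phi> has_real_derivative deriv \<phi> t) (at t)) \<and>
     continuous_on {t. 0 < t \<and> ereal t < \<eta>} (deriv \<phi>) \<and>
     (\<forall>t. 0 < t \<and> ereal t < \<eta> \<longrightarrow> 0 < deriv \<phi> t)"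

text \<open>The PLK condition at \<open>xbar\<close> for \<open>f\<close> on \<open>X\<close>, where \<open>G\<close> is the gradient of \<open>f\<close> on \<open>X\<close>.\<close>

definition PLK_condition ::
  "'a::real_normed_vector set \<Rightarrow> ('a \<Rightarrow> real) \<Rightarrow> ('a \<Rightarrow> 'a) \<Rightarrow> 'a \<Rightarrow> ereal \<Rightarrow> (real \<Rightarrow> real) \<Rightarrow> bool"
  where
  "PLK_condition X f G xbar \<eta> \<phi> \<longleftrightarrow>
     desingularizing \<eta> \<phi> \<and>
     (\<exists>U. xbar \<in> interior U \<and> U \<subseteq> X \<and>
        (\<forall>x\<in>U. f xbar < f x \<and> ereal (f x) < ereal (f xbar) + \<eta> \<longrightarrow>
           1 \<le> deriv \<phi> (f x - f xbar) * norm (G x)))"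

definition extrapolate :: "(nat \<Rightarrow> real) \<Rightarrow> (nat \<Rightarrow> 'a::real_vector) \<Rightarrow> nat \<Rightarrow> 'a" where
  "extrapolate c x k = x k + c k *\<^sub>R (x k - x (k - 1))"

text \<open>With momentum parameters \<open>\<beta>\<close> and \<open>\<gamma>\<close>, \<open>extrapolate \<beta> x\<close> is the inertial sequence
  (subscript \<open>in\<close>) and \<open>extrapolate \<gamma> x\<close> the extrapolated one (subscript \<open>ex\<close>). Both are
  meaningful for \<open>k \<ge> 1\<close> only.\<close>

definition EGm_sequence ::
  "('a::real_vector \<Rightarrow> 'a) \<Rightarrow> (nat \<Rightarrow> real) \<Rightarrow> (nat \<Rightarrow> real) \<Rightarrow> real \<Rightarrow> real \<Rightarrow> (nat \<Rightarrow> 'a) \<Rightarrow> bool"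
  where
  "EGm_sequence G \<beta> \<gamma> \<tau>1 \<tau>2 x \<longleftrightarrow>
     x 0 = x 1 \<and>
     (\<forall>k\<ge>1. x (k + 1) = extrapolate \<beta> x k
        - \<tau>1 *\<^sub>R G (extrapolate \<gamma> x k - \<tau>2 *\<^sub>R G (extrapolate \<gamma> x k)))"

definition converges_linearly :: "(nat \<Rightarrow> 'a::real_normed_vector) \<Rightarrow> 'a \<Rightarrow> bool" where
  "converges_linearly u l \<longleftrightarrow> (\<exists>\<mu>. 0 < \<mu> \<and> \<mu> < 1 \<and> (\<lambda>k. norm (u k - l)) \<in> O(\<lambda>k. \<mu> ^ k))"

end

theory Submission
  imports Defs
begin

text \<open>
  Write \<open>d k = x k - x (k - 1)\<close>. The bound on \<open>\<tau>2\<close> makes the extragradient an approximation of the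
  gradient at the extrapolated point with relative error \<open>\<nu>\<close>. Hence, with \<open>\<beta>\<^sup>2 < 1 - \<nu>\<close> and \<open>\<tau>1\<close>
  small, the energy \<open>W k = f (x k) - f xbar + \<kappa> / (2 \<tau>1) |d k|\<^sup>2\<close> decreases by a multiple of
  \<open>(D k)\<^sup>2 / \<tau>1\<close>, where \<open>D k = |d k| + |d (k + 1)|\<close>, while \<open>\<tau>1 |G (x k)| \<le> 3 D k\<close>. The PLK
  inequality controls \<open>f\<close> but not \<open>W\<close>, so \<open>\<psi>\<close> is replaced by its sup-convolution with the square
  root, \<open>\<Psi> v = sup {\<psi> s + 2 sqrt (v - s) | 0 \<le> s \<le> v}\<close>, the square root accounting for the
  kinetic term. Then \<open>D k \<le> K (\<Psi> (W k) - \<Psi> (W (k + 1)))\<close> with \<open>K\<close> independent of \<open>\<tau>1\<close>. The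
  telescoping sum keeps the trajectory near \<open>xbar\<close> and gives convergence to a limit \<open>xt\<close> with
  \<open>|x k - xt| \<le> K \<Psi> (W k)\<close>. If \<open>\<psi> t = M t powr (1 - q)\<close> with \<open>q \<ge> 1/2\<close>, then the energy
  satisfies \<open>c (W k) powr (2 q) \<le> W k - W (k + 1)\<close> and \<open>\<Psi> v = O(v powr (1 - q))\<close>, which yields the
  rates.
\<close>

subsection \<open>The extragradient step\<close>

text \<open>The descent lemma. Along the segment from \<open>x\<close> to \<open>y\<close>,
  \<open>f\<close> minus its quadratic upper model has nonpositive derivative, by Cauchy-Schwarz and
  the Lipschitz bound, so no integral of the gradient is needed.\<close>

lemma smooth_upper_bound:
  fixes f :: "'a::real_inner \<Rightarrow> real"
  assumes "convex S" and x: "x \<in> S" and y: "y \<in> S"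
    and grad: "\<forall>z\<in>S. GDERIV f z :> G z"
    and lip: "\<forall>u\<in>S. \<forall>v\<in>S. norm (G u - G v) \<le> L * norm (u - v)"
  shows "f y \<le> f x + G x \<bullet> (y - x) + L / 2 * (norm (y - x))\<^sup>2"
proof -
  define z where "z t = x + t *\<^sub>R (y - x)" for t
  define h where "h t = f (z t) - t * (G x \<bullet> (y - x)) - L / 2 * t\<^sup>2 * (norm (y - x))\<^sup>2" for t
  have zS: "z t \<in> S" if "0 \<le> t" "t \<le> 1" for t
  proof -
    have "z t = (1 - t) *\<^sub>R x + t *\<^sub>R y" by (simp add: z_def algebra_simps)
    then show ?thesis using convexD_alt[OF \<open>convex S\<close> x y that] by simp
  qed
  have "h 1 \<le> h 0"
  proof (rule DERIV_nonpos_imp_nonincreasing[of 0 1 h])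
    fix t :: real assume t: "0 \<le> t" "t \<le> 1"
    define D where "D = (y - x) \<bullet> G (z t) - G x \<bullet> (y - x) - L * t * (norm (y - x))\<^sup>2"
    have "(f has_derivative (\<lambda>h. h \<bullet> G (z t))) (at (z t))"
      using bspec[OF grad zS[OF t]] by (simp add: gderiv_def)
    moreover have "(z has_derivative (\<lambda>s. s *\<^sub>R (y - x))) (at t)"
      unfolding z_def by (auto intro!: derivative_eq_intros)
    ultimately have "((\<lambda>s. f (z s)) has_derivative (\<lambda>s. (s *\<^sub>R (y - x)) \<bullet> G (z t))) (at t)"
      by (rule has_derivative_compose[rotated])
    then have fz: "((\<lambda>s. f (z s)) has_real_derivative (y - x) \<bullet> G (z t)) (at t)"
      by (simp add: has_field_derivative_def mult_commute_abs)
    note fz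
    moreover have "((\<lambda>t. t * (G x \<bullet> (y - x))) has_real_derivative G x \<bullet> (y - x)) (at t)"
      by (auto intro!: derivative_eq_intros)
    moreover have "((\<lambda>t. L / 2 * t\<^sup>2 * (norm (y - x))\<^sup>2) has_real_derivative L * t * (norm (y - x))\<^sup>2) (at t)"
      by (auto intro!: derivative_eq_intros)
    ultimately have "(h has_real_derivative D) (at t)"
      unfolding h_def D_def by (intro DERIV_diff)
    moreover have "D \<le> 0"
    proof -
      have "norm (G (z t) - G x) \<le> L * norm (z t - x)" using lip zS[OF t] x by simp
      also have "\<dots> = L * t * norm (y - x)" using t by (simp add: z_def)
      finally have "norm (G (z t) - G x) * norm (y - x) \<le> L * t * norm (y - x) * norm (y - x)"
        by (rule mult_right_mono) simp
      moreover have "(G (z t) - G x) \<bullet> (y - x) \<le> norm (G (z t) - G x) * norm (y - x)"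
        by (rule norm_cauchy_schwarz)
      ultimately show ?thesis
        by (simp add: D_def inner_commute inner_diff_right inner_diff_left power2_eq_square)
    qed
    ultimately show "\<exists>D. (h has_real_derivative D) (at t) \<and> D \<le> 0" by blast
  qed simp
  then show ?thesis by (simp add: h_def z_def)
qed

lemma gradient_zero_at_minimum:
  fixes f :: "'a::real_inner \<Rightarrow> real"
  assumes "GDERIV f x :> D" and "e > 0" and "\<And>y. y \<in> ball x e \<Longrightarrow> f x \<le> f y"
  shows "D = 0"
proof -
  have "(f has_derivative (\<lambda>h. h \<bullet> D)) (at x)" using assms(1) by (simp add: gderiv_def)
  then have "(\<lambda>h. h \<bullet> D) = (\<lambda>v. 0)"
    by (rule differential_zero_maxmin[of x "ball x e", rotated 2]) (use assms in auto)
  from fun_cong[OF this, of D] have "D \<bullet> D = 0" .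
  then show ?thesis by simp
qed

text \<open>With \<open>p\<close> the extragradient direction, the step is
  \<open>b d - d' = \<tau>1 p\<close> and behaves like an inexact gradient step: \<open>p\<close> is
  within \<open>\<nu> |p|\<close> of the gradient at the extrapolated point, which is within
  \<open>L c |d|\<close> of \<open>G x\<close>. Both claims are multiplied by
  \<open>\<tau>1\<close>, so that no division by the stepsize occurs yet.\<close>

lemma extragradient_step:
  fixes f :: "'a::real_inner \<Rightarrow> real"
  assumes "convex S"
    and grad: "\<forall>z\<in>S. GDERIV f z :> G z"
    and lip: "\<forall>u\<in>S. \<forall>v\<in>S. norm (G u - G v) \<le> L * norm (u - v)"
    and L: "0 < L" and \<nu>: "0 < \<nu>" "\<nu> < 1" and \<tau>1: "0 < \<tau>1"
    and \<tau>2: "0 \<le> \<tau>2" "\<tau>2 \<le> \<nu> / (L * (\<nu> + 1))" and "0 \<le> c"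
    and S: "x \<in> S" "x + c *\<^sub>R d \<in> S"
      "x + c *\<^sub>R d - \<tau>2 *\<^sub>R G (x + c *\<^sub>R d) \<in> S" "x + d' \<in> S"
    and d': "d' = b *\<^sub>R d - \<tau>1 *\<^sub>R G (x + c *\<^sub>R d - \<tau>2 *\<^sub>R G (x + c *\<^sub>R d))"
  shows "\<tau>1 * (f (x + d') - f x) \<le> (b\<^sup>2 * (norm d)\<^sup>2 - (1 - \<nu>) * (norm d')\<^sup>2) / 2
           + \<tau>1 * L * (c * norm d * norm d' + (norm d')\<^sup>2 / 2)"
    and "\<tau>1 * norm (G x) \<le> (1 + \<nu>) * norm (b *\<^sub>R d - d') + \<tau>1 * L * c * norm d"
proof -
  define e p w where "e = x + c *\<^sub>R d" and "p = G (e - \<tau>2 *\<^sub>R G e)" and "w = b *\<^sub>R d - d'"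
  have w: "w = \<tau>1 *\<^sub>R p" by (simp add: w_def d' e_def p_def)
  then have nw: "norm w = \<tau>1 * norm p" using \<tau>1 by simp
  \<comment> \<open>This form of the bound on \<open>\<tau>2\<close> gives an error of at most
    \<open>\<nu> / (1 + \<nu>)\<close> relative to \<open>G e\<close>; by the triangle inequality it
    is an error of at most \<open>\<nu>\<close> relative to \<open>p\<close>.\<close>
  have L\<tau>: "(1 + \<nu>) * (L * \<tau>2) \<le> \<nu>"
    using \<tau>2(2) L \<nu> by (simp add: pos_le_divide_eq mult.commute mult.left_commute add.commute)
  have "norm (p - G e) \<le> L * norm (e - \<tau>2 *\<^sub>R G e - e)"
    using bspec[OF bspec[OF lip S(3)] S(2)] unfolding p_def e_def .
  also have "\<dots> = L * \<tau>2 * norm (G e)" using \<tau>2 by simp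
  finally have "(1 + \<nu>) * norm (p - G e) \<le> (1 + \<nu>) * (L * \<tau>2 * norm (G e))"
    using \<nu> by (intro mult_left_mono) auto
  also have "\<dots> \<le> \<nu> * norm (G e)"
    using mult_right_mono[OF L\<tau>, of "norm (G e)"] by (simp add: mult.assoc)
  also have "\<dots> \<le> \<nu> * (norm p + norm (p - G e))"
    using \<nu> norm_triangle_sub[of "G e" p] by (intro mult_left_mono) (auto simp: norm_minus_commute)
  finally have err: "norm (p - G e) \<le> \<nu> * norm p" by (simp add: algebra_simps)
  have ex: "norm (G x - G e) \<le> L * c * norm d"
    using bspec[OF bspec[OF lip S(1)] S(2)] \<open>0 \<le> c\<close> by (simp add: e_def)
  have "norm (G x) \<le> norm p + norm (p - G e) + norm (G x - G e)" by norm
  then have "norm (G x) \<le> (1 + \<nu>) * norm p + L * c * norm d"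
    using err ex by (simp add: algebra_simps)
  from mult_left_mono[OF this, of \<tau>1]
  show "\<tau>1 * norm (G x) \<le> (1 + \<nu>) * norm (b *\<^sub>R d - d') + \<tau>1 * L * c * norm d"
    using \<tau>1 nw by (simp add: w_def algebra_simps)
  have "f (x + d') \<le> f x + G x \<bullet> (x + d' - x) + L / 2 * (norm (x + d' - x))\<^sup>2"
    by (rule smooth_upper_bound[OF \<open>convex S\<close> S(1,4) grad lip])
  then have desc: "f (x + d') - f x \<le> G x \<bullet> d' + L / 2 * (norm d')\<^sup>2" by simp
  have "G x \<bullet> d' = p \<bullet> d' + (G e - p) \<bullet> d' + (G x - G e) \<bullet> d'"
    by (simp add: inner_diff_left)
  also have "(G e - p) \<bullet> d' \<le> norm (G e - p) * norm d'" by (rule norm_cauchy_schwarz)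
  also have "\<dots> \<le> (\<nu> * norm p) * norm d'"
    using err by (intro mult_right_mono) (auto simp: norm_minus_commute)
  also have "(G x - G e) \<bullet> d' \<le> norm (G x - G e) * norm d'" by (rule norm_cauchy_schwarz)
  also have "\<dots> \<le> (L * c * norm d) * norm d'" using ex by (intro mult_right_mono) auto
  finally have "f (x + d') - f x \<le> p \<bullet> d' + \<nu> * norm p * norm d' + L * c * norm d * norm d' + L / 2 * (norm d')\<^sup>2"
    using desc by simp
  from mult_left_mono[OF this, of \<tau>1]
  have 1: "\<tau>1 * (f (x + d') - f x) \<le> w \<bullet> d' + \<nu> * (norm w * norm d') + \<tau>1 * L * (c * norm d * norm d' + (norm d')\<^sup>2 / 2)"
    using \<tau>1 nw w by (simp add: algebra_simps)
  \<comment> \<open>Polarization turns the inner product into squares. Its term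
    \<open>- |w|^2 / 2\<close> absorbs the \<open>\<nu> |w|^2 / 2\<close> that Young's inequality
    produces from the gradient error, since \<open>\<nu> < 1\<close>.\<close>
  have "b *\<^sub>R d = w + d'" by (simp add: w_def)
  then have "(norm (b *\<^sub>R d))\<^sup>2 = (norm w)\<^sup>2 + 2 * (w \<bullet> d') + (norm d')\<^sup>2"
    by (simp add: power2_norm_eq_inner inner_add_left inner_add_right inner_commute)
  then have 2: "w \<bullet> d' = (b\<^sup>2 * (norm d)\<^sup>2 - (norm w)\<^sup>2 - (norm d')\<^sup>2) / 2"
    by (simp add: power_mult_distrib)
  have "norm w * norm d' \<le> ((norm w)\<^sup>2 + (norm d')\<^sup>2) / 2"
    using sum_squares_bound[of "norm w" "norm d'"] by simp
  then have "\<nu> * (norm w * norm d') \<le> \<nu> * (((norm w)\<^sup>2 + (norm d')\<^sup>2) / 2)"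
    using \<nu> by (intro mult_left_mono) auto
  moreover have "0 \<le> (1 - \<nu>) * (norm w)\<^sup>2" using \<nu> by simp
  ultimately show "\<tau>1 * (f (x + d') - f x) \<le> (b\<^sup>2 * (norm d)\<^sup>2 - (1 - \<nu>) * (norm d')\<^sup>2) / 2
           + \<tau>1 * L * (c * norm d * norm d' + (norm d')\<^sup>2 / 2)"
    using 1 2 by (simp add: algebra_simps add_divide_distrib diff_divide_distrib)
qed

text \<open>The weight \<open>\<kappa>\<close> lies in the gap between \<open>B^2\<close> and
  \<open>1 - \<nu>\<close>. In the coefficient of \<open>|d|^2\<close> its part
  \<open>2 \<epsilon>\<close> is shared equally by the extrapolation error, which the bound on
  \<open>\<tau>1\<close> makes at most \<open>\<epsilon> / 2\<close>, and the dissipation term. In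
  the coefficient of \<open>|d'|^2\<close> the room \<open>8 \<epsilon>\<close> outweighs all the
  error terms.\<close>

lemma extragradient_lyapunov_step:
  fixes f :: "'a::real_inner \<Rightarrow> real"
  assumes "convex S"
    and grad: "\<forall>z\<in>S. GDERIV f z :> G z"
    and lip: "\<forall>u\<in>S. \<forall>v\<in>S. norm (G u - G v) \<le> L * norm (u - v)"
    and L: "0 < L" and \<nu>: "0 < \<nu>" "\<nu> < 1"
    and \<tau>1: "0 < \<tau>1" "\<tau>1 * (L * (1 + C)) \<le> \<epsilon>"
    and \<tau>2: "0 \<le> \<tau>2" "\<tau>2 \<le> \<nu> / (L * (\<nu> + 1))"
    and b: "0 \<le> b" "b \<le> B" and c: "0 \<le> c" "c \<le> C"
    and \<epsilon>: "0 < \<epsilon>" "8 * \<epsilon> \<le> 1 - \<nu> - B\<^sup>2" and \<kappa>: "\<kappa> = B\<^sup>2 + 2 * \<epsilon>"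
    and S: "x \<in> S" "x + c *\<^sub>R d \<in> S"
      "x + c *\<^sub>R d - \<tau>2 *\<^sub>R G (x + c *\<^sub>R d) \<in> S" "x + d' \<in> S"
    and d': "d' = b *\<^sub>R d - \<tau>1 *\<^sub>R G (x + c *\<^sub>R d - \<tau>2 *\<^sub>R G (x + c *\<^sub>R d))"
  shows "f (x + d') + \<kappa> / (2 * \<tau>1) * (norm d')\<^sup>2 + \<epsilon> / (4 * \<tau>1) * (norm d + norm d')\<^sup>2
           \<le> f x + \<kappa> / (2 * \<tau>1) * (norm d)\<^sup>2"
    and "norm (G x) \<le> 3 / \<tau>1 * (norm d + norm d')"
proof -
  define m n where "m = norm d" and "n = norm d'"
  have mn: "0 \<le> m" "0 \<le> n" by (auto simp: m_def n_def)
  note step = extragradient_step[OF \<open>convex S\<close> grad lip L \<nu> \<tau>1(1) \<tau>2 c(1) S d',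
      folded m_def n_def]
  have B2: "b\<^sup>2 \<le> B\<^sup>2" using b by (intro power_mono) auto
  have B1: "B < 1"
  proof (rule ccontr)
    assume "\<not> B < 1"
    then have "1 \<le> B\<^sup>2" by simp
    then show False using \<epsilon> \<nu> by simp
  qed
  have "\<tau>1 * L \<le> \<tau>1 * (L * (1 + C))" using \<tau>1 L b c by (intro mult_left_mono) auto
  then have \<tau>L: "\<tau>1 * L \<le> \<epsilon>" using \<tau>1(2) by linarith
  have "\<tau>1 * L * c \<le> \<tau>1 * (L * (1 + C))"
    using \<tau>1 L c by (simp add: mult.assoc mult_left_mono)
  then have \<tau>Lc: "\<tau>1 * L * c \<le> \<epsilon>" using \<tau>1(2) by linarith
  have 1: "\<tau>1 * L * c * (m * n) \<le> \<epsilon> * ((m\<^sup>2 + n\<^sup>2) / 2)"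
    using \<tau>Lc mn sum_squares_bound[of m n] \<epsilon> by (intro mult_mono) auto
  have 2: "\<tau>1 * L * n\<^sup>2 \<le> \<epsilon> * n\<^sup>2" using \<tau>L by (intro mult_right_mono) auto
  have 3: "b\<^sup>2 * m\<^sup>2 \<le> B\<^sup>2 * m\<^sup>2" using B2 by (intro mult_right_mono) auto
  have 4: "8 * \<epsilon> * n\<^sup>2 \<le> (1 - \<nu> - B\<^sup>2) * n\<^sup>2" using \<epsilon> by (intro mult_right_mono) auto
  have 6: "\<epsilon> * (m + n)\<^sup>2 \<le> \<epsilon> * (2 * m\<^sup>2 + 2 * n\<^sup>2)"
    using \<epsilon> sum_squares_bound[of m n] by (intro mult_left_mono) (auto simp: power2_sum)
  have 7: "0 \<le> \<epsilon> * n\<^sup>2" using \<epsilon> by simp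
  have "\<tau>1 * (f (x + d') - f x) + \<kappa> / 2 * n\<^sup>2 + \<epsilon> / 4 * (m + n)\<^sup>2 \<le> \<kappa> / 2 * m\<^sup>2"
  proof -
    \<comment> \<open>Once the products are named, the remaining inequality is linear in
      them.\<close>
    define em en Bm Bn vn where "em = \<epsilon> * m\<^sup>2" and "en = \<epsilon> * n\<^sup>2"
      and "Bm = B\<^sup>2 * m\<^sup>2" and "Bn = B\<^sup>2 * n\<^sup>2" and "vn = (1 - \<nu>) * n\<^sup>2"
    have "\<tau>1 * L * (c * m * n + n\<^sup>2 / 2) = \<tau>1 * L * c * (m * n) + \<tau>1 * L * n\<^sup>2 / 2"
      by (simp add: algebra_simps)
    also have "\<dots> \<le> em / 2 + en"
      using 1 2 by (simp add: em_def en_def algebra_simps add_divide_distrib)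
    finally have "\<tau>1 * (f (x + d') - f x) \<le> (b\<^sup>2 * m\<^sup>2 - vn) / 2 + (em / 2 + en)"
      using order_trans[OF step(1) add_left_mono] by (simp add: vn_def)
    moreover have "8 * en + Bn \<le> vn" using 4 by (simp add: en_def Bn_def vn_def algebra_simps)
    moreover have "\<epsilon> / 4 * (m + n)\<^sup>2 \<le> em / 2 + en / 2"
      using 6 by (simp add: en_def em_def algebra_simps)
    moreover have "\<kappa> / 2 * m\<^sup>2 = Bm / 2 + em" "\<kappa> / 2 * n\<^sup>2 = Bn / 2 + en"
      by (simp_all add: \<kappa> en_def em_def Bm_def Bn_def algebra_simps)
    moreover have "b\<^sup>2 * m\<^sup>2 \<le> Bm" "0 \<le> en" using 3 7 by (auto simp: en_def Bm_def)
    ultimately show ?thesis by argo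
  qed
  from divide_right_mono[OF this, of \<tau>1]
  show "f (x + d') + \<kappa> / (2 * \<tau>1) * (norm d')\<^sup>2 + \<epsilon> / (4 * \<tau>1) * (norm d + norm d')\<^sup>2
           \<le> f x + \<kappa> / (2 * \<tau>1) * (norm d)\<^sup>2"
    using \<tau>1(1) unfolding m_def[symmetric] n_def[symmetric]
    by (simp add: add_divide_distrib mult.commute[of \<tau>1 2] mult.commute[of \<tau>1 4])
  have "norm (b *\<^sub>R d - d') \<le> b * m + n"
    using norm_triangle_ineq4[of "b *\<^sub>R d" d'] b by (simp add: m_def n_def)
  also have "\<dots> \<le> m + n" using mult_left_le_one_le[of m b] mn b B1 by simp
  finally have "(1 + \<nu>) * norm (b *\<^sub>R d - d') \<le> 2 * (m + n)" using \<nu> by (intro mult_mono) auto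
  moreover have "\<tau>1 * L * c * m \<le> 1 * m"
    using \<tau>Lc \<epsilon> \<nu> mn zero_le_power2[of B] by (intro mult_right_mono) linarith+
  ultimately have "\<tau>1 * norm (G x) \<le> 3 * (m + n)" using step(2) mn by simp
  then show "norm (G x) \<le> 3 / \<tau>1 * (norm d + norm d')"
    using \<tau>1 by (simp add: field_simps m_def n_def)
qed

subsection \<open>Desingularizing functions\<close>

text \<open>Concavity enters the proof through this inequality: at interior points the tangent lies
  above the graph.\<close>

lemma desingularizing_tangent:
  assumes "desingularizing \<eta> \<psi>" and s: "0 < s" "ereal s < \<eta>" and u: "0 \<le> u" "ereal u < \<eta>"
  shows "\<psi> u \<le> \<psi> s + deriv \<psi> s * (u - s)"
proof -
  let ?A = "{t. 0 \<le> t \<and> ereal t < \<eta>}"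
  have conc: "concave_on ?A \<psi>" and der: "(\<psi> has_real_derivative deriv \<psi> s) (at s)"
    using assms unfolding desingularizing_def by blast+
  have cv: "convex_on ?A (\<lambda>t. - \<psi> t)" using conc by (simp add: concave_on_def)
  have "open {t. 0 < t \<and> ereal t < \<eta>}"
  proof -
    have "open (ereal -` {..<\<eta>})" by (intro open_vimage continuous_on_ereal) auto
    then have "open ({0<..} \<inter> (ereal -` {..<\<eta>}))" by (intro open_Int) auto
    moreover have "{0<..} \<inter> (ereal -` {..<\<eta>}) = {t. 0 < t \<and> ereal t < \<eta>}" by auto
    ultimately show ?thesis by simp
  qed
  then have "s \<in> interior ?A" using s by (intro interiorI[of "{t. 0 < t \<and> ereal t < \<eta>}"]) auto
  moreover have "((\<lambda>t. - \<psi> t) has_field_derivative - deriv \<psi> s) (at s within ?A)"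
    using DERIV_minus[OF der] by (rule has_field_derivative_at_within)
  moreover have "connected ?A"
    using convex_on_imp_convex[OF cv] by (rule convex_connected)
  ultimately have "- \<psi> u - (- \<psi> s) \<ge> - deriv \<psi> s * (u - s)"
    using u by (intro convex_on_imp_above_tangent[OF cv]) auto
  then show ?thesis by (simp add: algebra_simps)
qed

text \<open>\<open>\<psi>\<close> may be discontinuous at \<open>0\<close>, in which case small energies would not give short
  trajectories.\<close>

lemma desingularizing_remove_jump:
  assumes des: "desingularizing \<eta> \<psi>"
  obtains \<phi> where "\<phi> 0 = 0"
    and "\<And>t. 0 \<le> t \<Longrightarrow> ereal t < \<eta> \<Longrightarrow> \<phi> t \<le> \<psi> t"
    and "\<And>s u. 0 < s \<Longrightarrow> ereal s < \<eta> \<Longrightarrow> 0 \<le> u \<Longrightarrow> ereal u < \<eta>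
          \<Longrightarrow> \<phi> u \<le> \<phi> s + deriv \<psi> s * (u - s)"
    and "\<And>e. 0 < e \<Longrightarrow> \<exists>\<delta>>0. \<forall>t. 0 \<le> t \<and> t < \<delta> \<longrightarrow> \<phi> t < e"
proof -
  let ?P = "{t. 0 < t \<and> ereal t < \<eta>}"
  \<comment> \<open>As \<open>\<psi>\<close> is nondecreasing, this infimum is its right limit at
    \<open>0\<close>, the height of the jump. Subtracting it off \<open>0\<close> changes no slope
    and makes the right limit equal to the value at \<open>0\<close>.\<close>
  define m where "m = Inf (\<psi> ` ?P)"
  define \<phi> where "\<phi> t = (if t = 0 then 0 else \<psi> t - m)" for t
  have eta: "0 < \<eta>" and \<psi>0: "\<psi> 0 = 0" and nn: "\<And>t. t \<in> ?P \<Longrightarrow> 0 \<le> \<psi> t"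
    and dpos: "\<And>t. t \<in> ?P \<Longrightarrow> 0 < deriv \<psi> t"
    using des unfolding desingularizing_def by auto
  have ne: "?P \<noteq> {}"
    using ereal_dense2[OF eta] by (auto simp: zero_ereal_def)
  have bb: "bdd_below (\<psi> ` ?P)" using nn by (intro bdd_belowI[of _ 0]) auto
  have m_le: "m \<le> \<psi> t" if "t \<in> ?P" for t unfolding m_def using bb that by (intro cINF_lower) auto
  have m_nn: "0 \<le> m" unfolding m_def using ne nn by (intro cINF_greatest) auto
  have tan: "\<psi> u \<le> \<psi> s + deriv \<psi> s * (u - s)" if "s \<in> ?P" "u \<in> ?P" for s u
    using desingularizing_tangent[OF des, of s u] that by auto
  have mono: "\<psi> u \<le> \<psi> s" if "u \<le> s" "s \<in> ?P" "u \<in> ?P" for s u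
  proof -
    have "deriv \<psi> s * (u - s) \<le> 0"
      using dpos[OF that(2)] that(1) by (intro mult_nonneg_nonpos) auto
    then show ?thesis using tan[OF that(2,3)] by linarith
  qed
  \<comment> \<open>The tangent inequality for \<open>\<phi>\<close> at \<open>u = 0\<close> is the
    limit of those for \<open>\<psi>\<close> as \<open>u\<close> tends to \<open>0\<close>. The
    choice of \<open>u\<close> stays in the domain and makes the error at most
    \<open>e\<close>.\<close>
  have tan0: "0 \<le> \<psi> s - m + deriv \<psi> s * (0 - s)" if s: "s \<in> ?P" for s
  proof (rule field_le_epsilon)
    fix e :: real assume e: "0 < e"
    define u where "u = min s (e / deriv \<psi> s)"
    have g: "0 < deriv \<psi> s" using dpos s by blast
    have u0: "0 < u" "u \<le> s" using s e g by (auto simp: u_def)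
    moreover have "ereal u < \<eta>" using u0(2) s by (auto intro: le_less_trans[of _ "ereal s"])
    ultimately have uP: "u \<in> ?P" by simp
    have "deriv \<psi> s * u \<le> deriv \<psi> s * (e / deriv \<psi> s)"
      using g by (intro mult_left_mono) (auto simp: u_def)
    also have "\<dots> = e" using g by simp
    finally show "0 \<le> \<psi> s - m + deriv \<psi> s * (0 - s) + e"
      using tan[OF s uP] m_le[OF uP] by (simp add: right_diff_distrib)
  qed
  show thesis
  proof (rule that[of \<phi>])
    show "\<phi> 0 = 0" by (simp add: \<phi>_def)
    show "\<phi> t \<le> \<psi> t" if "0 \<le> t" "ereal t < \<eta>" for t
      using m_nn \<psi>0 by (simp add: \<phi>_def)
    show "\<phi> u \<le> \<phi> s + deriv \<psi> s * (u - s)"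
      if "0 < s" "ereal s < \<eta>" "0 \<le> u" "ereal u < \<eta>" for s u
      using tan[of s u] tan0[of s] that by (cases "u = 0") (auto simp: \<phi>_def)
    show "\<exists>\<delta>>0. \<forall>t. 0 \<le> t \<and> t < \<delta> \<longrightarrow> \<phi> t < e" if e: "0 < e" for e
    proof -
      have "Inf (\<psi> ` ?P) < m + e" using e by (simp add: m_def)
      then obtain u where u: "u \<in> ?P" "\<psi> u < m + e"
        unfolding cINF_less_iff[OF ne bb] by blast
      have "\<phi> t < e" if t: "0 \<le> t" "t < u" for t
      proof (cases "t = 0")
        case False
        have "ereal t < \<eta>" using t(2) u(1) by (auto intro: less_trans[of "ereal t" "ereal u"])
        then have "\<psi> t \<le> \<psi> u" using mono[of t u] t u False by auto
        then show ?thesis using u False by (simp add: \<phi>_def)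
      qed (use e in \<open>simp add: \<phi>_def\<close>)
      then show ?thesis using u(1) by auto
    qed
  qed
qed

text \<open>The factor 2 normalizes the slope of the root to \<open>1 / l\<close> at
  \<open>l^2\<close>, the slope that the PLK inequality gives to \<open>\<phi>\<close> when the
  gradient norm is at most \<open>l\<close>.\<close>

definition sqrt_regularization :: "(real \<Rightarrow> real) \<Rightarrow> real \<Rightarrow> real" where
  "sqrt_regularization \<phi> v = (SUP s\<in>{0..v}. \<phi> s + 2 * sqrt (v - s))"

text \<open>Here \<open>g s\<close> is just a supergradient of \<open>\<phi>\<close> at
  \<open>s\<close>. In the application \<open>g\<close> is the derivative of \<open>\<psi>\<close>
  while \<open>\<phi>\<close> is \<open>\<psi>\<close> without its jump.\<close>

locale tangent_majorized =
  fixes \<phi> g :: "real \<Rightarrow> real" and \<eta> :: real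
  assumes phi_zero: "\<phi> 0 = 0"
    and tangent: "\<And>s u. 0 < s \<Longrightarrow> s < \<eta> \<Longrightarrow> 0 \<le> u \<Longrightarrow> u < \<eta> \<Longrightarrow> \<phi> u \<le> \<phi> s + g s * (u - s)"
    and slope_pos: "\<And>s. 0 < s \<Longrightarrow> s < \<eta> \<Longrightarrow> 0 < g s"
begin

lemma phi_mono: "\<phi> u \<le> \<phi> s" if "0 \<le> u" "u \<le> s" "s < \<eta>"
proof (cases "s = 0")
  case False
  then have "g s * (u - s) \<le> 0" using that slope_pos[of s] by (intro mult_nonneg_nonpos) auto
  then show ?thesis using tangent[of s u] that False by simp
qed (use that in simp)

text \<open>The sum of the tangent inequalities at \<open>s\<close> and at
  \<open>s'\<close>.\<close>

lemma slope_antimono: "g s' \<le> g s" if "0 < s" "s \<le> s'" "s' < \<eta>"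
proof (cases "s = s'")
  case False
  have "0 \<le> (g s - g s') * (s' - s)"
    using tangent[of s s'] tangent[of s' s] that by (simp add: algebra_simps)
  then show ?thesis using that False by (simp add: zero_le_mult_iff)
qed simp

abbreviation "\<Psi> \<equiv> sqrt_regularization \<phi>"

text \<open>Monotonicity of \<open>\<phi>\<close> below \<open>\<eta>\<close> bounds the set under
  the supremum; without such a bound the real supremum would carry no information.\<close>

lemma reg_candidate: "0 \<le> s \<Longrightarrow> s \<le> v \<Longrightarrow> v < \<eta> \<Longrightarrow> \<phi> s + 2 * sqrt (v - s) \<le> \<Psi> v"
  unfolding sqrt_regularization_def
proof (rule cSUP_upper)
  assume "v < \<eta>"
  then show "bdd_above ((\<lambda>s. \<phi> s + 2 * sqrt (v - s)) ` {0..v})"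
    by (intro bdd_aboveI2[of _ _ "\<phi> v + 2 * sqrt v"] add_mono phi_mono) auto
qed simp

lemma reg_leI: "0 \<le> v \<Longrightarrow> (\<And>s. 0 \<le> s \<Longrightarrow> s \<le> v \<Longrightarrow> \<phi> s + 2 * sqrt (v - s) \<le> z) \<Longrightarrow> \<Psi> v \<le> z"
  unfolding sqrt_regularization_def by (rule cSUP_least) auto

lemma reg_le: "0 \<le> v \<Longrightarrow> v < \<eta> \<Longrightarrow> \<Psi> v \<le> \<phi> v + 2 * sqrt v"
  by (intro reg_leI add_mono phi_mono) auto

lemma reg_nonneg: assumes "0 \<le> v" "v < \<eta>" shows "0 \<le> \<Psi> v"
proof -
  have "0 \<le> \<phi> 0 + 2 * sqrt (v - 0)" using assms phi_zero by simp
  also have "\<dots> \<le> \<Psi> v" using assms by (intro reg_candidate) auto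
  finally show ?thesis .
qed

lemma reg_mono: "0 \<le> u \<Longrightarrow> u \<le> v \<Longrightarrow> v < \<eta> \<Longrightarrow> \<Psi> u \<le> \<Psi> v"
proof (rule reg_leI)
  fix s assume "u \<le> v" "v < \<eta>" "0 \<le> s" "s \<le> u"
  then have "\<phi> s + 2 * sqrt (v - s) \<le> \<Psi> v" by (intro reg_candidate) auto
  moreover have "sqrt (u - s) \<le> sqrt (v - s)" using \<open>u \<le> v\<close> by simp
  ultimately show "\<phi> s + 2 * sqrt (u - s) \<le> \<Psi> v" by linarith
qed

text \<open>An increment of \<open>v'\<close> is added to \<open>s'\<close> in a decomposition \<open>v' = s' + t'\<close> if this keeps
  the argument of \<open>\<phi>\<close> below \<open>s\<close>, where \<open>\<phi>\<close> has slope at least \<open>1/l\<close>; otherwise \<open>t'\<close> is at most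
  \<open>l\<^sup>2\<close> and it is added to \<open>t'\<close>.\<close>

lemma reg_increase:
  assumes v': "0 \<le> v'" "v < \<eta>" "v = v' + \<delta>" and \<delta>: "0 \<le> \<delta>" "\<delta> \<le> l\<^sup>2" and l: "0 < l"
    and s: "v \<le> s + l\<^sup>2" "s < \<eta>" "0 < s \<Longrightarrow> 1 \<le> g s * l"
  shows "\<Psi> v' + \<delta> / (2 * l) \<le> \<Psi> v"
proof (cases "\<delta> = 0")
  case False
  then have \<delta>0: "0 < \<delta>" using \<delta> by simp
  have "\<Psi> v' \<le> \<Psi> v - \<delta> / (2 * l)"
  proof (rule reg_leI)
    fix s' assume s': "0 \<le> s'" "s' \<le> v'"
    show "\<phi> s' + 2 * sqrt (v' - s') \<le> \<Psi> v - \<delta> / (2 * l)"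
    proof (cases "s' + \<delta> \<le> s")
      case True
      let ?m = "s' + \<delta>"
      have m: "0 < ?m" using \<delta>0 s' by simp
      have "1 \<le> g s * l" using s(3) m True by simp
      also have "\<dots> \<le> g ?m * l" using slope_antimono[OF m True s(2)] l by (intro mult_right_mono) auto
      finally have "\<delta> / (2 * l) \<le> g ?m * l * (\<delta> / l)"
        using \<delta>0 l mult_right_mono[of 1 "g ?m * l" "\<delta> / l"] by (simp add: field_simps)
      also have "\<dots> = g ?m * \<delta>" using l by simp
      also have "\<dots> \<le> \<phi> ?m - \<phi> s'" using tangent[of ?m s'] m True s s' \<delta> by simp
      finally have "\<phi> s' + \<delta> / (2 * l) \<le> \<phi> ?m" by simp
      moreover have "\<phi> ?m + 2 * sqrt (v - ?m) \<le> \<Psi> v"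
        using v' s' m by (intro reg_candidate) auto
      ultimately show ?thesis using v' by simp
    next
      case False
      define t where "t = v' - s'"
      have t: "0 \<le> t" using s' by (simp add: t_def)
      \<comment> \<open>In this case \<open>v - s' < (v - s) + \<delta> \<le> 2 l^2\<close>. The
        cruder bound \<open>4 l^2\<close> has a rational root, and up to there \<open>2 sqrt\<close>
        has slope at least \<open>1 / (2 l)\<close>.\<close>
      have "t + \<delta> \<le> (2 * l)\<^sup>2" using False s v' \<delta> by (simp add: t_def power_mult_distrib)
      then have sq: "sqrt (t + \<delta>) \<le> 2 * l" using l by (intro real_le_lsqrt) auto
      have le: "sqrt t \<le> sqrt (t + \<delta>)" using \<delta> by simp
      have "\<delta> = (sqrt (t + \<delta>))\<^sup>2 - (sqrt t)\<^sup>2" using t \<delta> by simp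
      also have "\<dots> = (sqrt (t + \<delta>) - sqrt t) * (sqrt (t + \<delta>) + sqrt t)"
        by (simp add: power2_eq_square algebra_simps)
      also have "\<dots> \<le> (sqrt (t + \<delta>) - sqrt t) * (4 * l)"
        by (rule mult_left_mono) (use sq le in linarith)+
      finally have "\<delta> / (2 * l) \<le> 2 * sqrt (t + \<delta>) - 2 * sqrt t"
        using l by (simp add: field_simps)
      moreover have "\<phi> s' + 2 * sqrt (v - s') \<le> \<Psi> v" using s' v' \<delta> by (intro reg_candidate) auto
      moreover have "v - s' = t + \<delta>" using v' by (simp add: t_def)
      ultimately show ?thesis by (simp add: t_def)
    qed
  qed (use v' in simp)
  then show ?thesis by simp
qed (use v' in simp)

end

subsection \<open>Trajectories\<close>

text \<open>A discrete form of the differential inequality \<open>a' \<le> - c a^p\<close>: the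
  quantity \<open>a^(1 - p)\<close> grows by at least \<open>c (p - 1)\<close> in each step, hence
  at least linearly.\<close>

lemma power_decay_rate:
  fixes a :: "nat \<Rightarrow> real"
  assumes nn: "\<And>k. k \<ge> 1 \<Longrightarrow> 0 \<le> a k" and c: "0 < c" and p: "1 < p"
    and dec: "\<And>k. k \<ge> 1 \<Longrightarrow> c * a k powr p \<le> a k - a (k + 1)"
  shows "a \<in> O(\<lambda>k. real k powr (- (1 / (p - 1))))"
proof -
  have mono: "a (k + 1) \<le> a k" if "k \<ge> 1" for k
    using dec[OF that] c powr_ge_zero[of "a k" p] by (smt (verit) mult_nonneg_nonneg)
  \<comment> \<open>The alternative \<open>a k = 0\<close> is carried along because
    \<open>0 powr (1 - p)\<close> is \<open>0\<close> rather than infinite. The recursion starts at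
    index 1, hence the factor \<open>real k - 1\<close>.\<close>
  have inv: "a k = 0 \<or> c * (p - 1) * (real k - 1) \<le> a k powr (1 - p)" if "k \<ge> 1" for k
    using that
  proof (induction k rule: dec_induct)
    case base
    show ?case by simp
  next
    case (step k)
    then have k: "1 \<le> k" by simp
    show ?case
    proof (cases "a (Suc k) = 0")
      case False
      then have b: "0 < a (Suc k)" using nn[of "Suc k"] by simp
      then have ak: "0 < a k" using mono[OF k] by simp
      \<comment> \<open>With the ratio \<open>w\<close>, the bounds \<open>ln w \<le> w - 1\<close>
        and \<open>1 + z \<le> exp z\<close> for \<open>z = (1 - p) ln w\<close> play the role of
        Bernoulli's inequality for the negative exponent \<open>1 - p\<close>.\<close>
      define w where "w = a (Suc k) / a k"
      have w: "0 < w" using b ak by (simp add: w_def)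
      have "c * a k powr p / a k \<le> (a k - a (k+1)) / a k"
        using dec[OF k] ak by (simp add: divide_right_mono)
      moreover have "a k powr (p - 1) = a k powr p / a k"
        using ak by (simp add: powr_diff)
      ultimately have "c * a k powr (p - 1) \<le> 1 - w"
        using ak by (simp add: w_def diff_divide_distrib)
      also have "\<dots> \<le> - ln w" using ln_le_minus_one[OF w] by simp
      finally have "(p - 1) * (c * a k powr (p - 1)) \<le> (p - 1) * (- ln w)"
        using p by (intro mult_left_mono) auto
      moreover have "1 + (1 - p) * ln w \<le> w powr (1 - p)"
        using exp_ge_add_one_self[of "(1 - p) * ln w"] w by (simp add: powr_def)
      ultimately have 1: "1 + (p - 1) * (c * a k powr (p - 1)) \<le> w powr (1 - p)"
        by (simp add: algebra_simps)
      have "a k powr (1 - p) * a k powr (p - 1) = 1"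
        using ak by (simp flip: powr_add)
      then have "a k powr (1 - p) + c * (p - 1) = a k powr (1 - p) * (1 + (p - 1) * (c * a k powr (p - 1)))"
        by (simp add: algebra_simps)
      also have "\<dots> \<le> a k powr (1 - p) * w powr (1 - p)"
        using 1 by (intro mult_left_mono) auto
      also have "\<dots> = a (Suc k) powr (1 - p)"
        using ak w by (simp add: w_def powr_mult[symmetric])
      finally have "a k powr (1 - p) + c * (p - 1) \<le> a (Suc k) powr (1 - p)" .
      moreover have "c * (p - 1) * (real k - 1) \<le> a k powr (1 - p)" using step.IH ak by simp
      ultimately show ?thesis by (simp add: algebra_simps)
    qed simp
  qed
  define C where "C = (c * (p - 1) / 2) powr (- (1 / (p - 1)))"
  \<comment> \<open>From index 2 on, \<open>k - 1\<close> is at least \<open>k / 2\<close>, which is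
    the source of the 2 in \<open>C\<close>.\<close>
  have bound: "a k \<le> C * real k powr (- (1 / (p - 1)))" if k: "k \<ge> 2" for k
  proof (cases "a k = 0")
    case True
    then show ?thesis by (simp add: C_def)
  next
    case False
    then have ak: "0 < a k" using nn[of k] k by simp
    have "c * (p - 1) / 2 * real k \<le> c * (p - 1) * (real k - 1)"
      using k c p mult_left_mono[of "real k / 2" "real k - 1" "c * (p - 1)"] by simp
    also have "\<dots> \<le> a k powr (1 - p)" using inv[of k] k False by simp
    finally have "(a k powr (1 - p)) powr (- (1 / (p - 1))) \<le> (c * (p - 1) / 2 * real k) powr (- (1 / (p - 1)))"
      using k c p by (intro powr_mono2') auto
    moreover have "(1 - p) * (- (1 / (p - 1))) = 1" using p by (simp add: field_simps)
    then have "(a k powr (1 - p)) powr (- (1 / (p - 1))) = a k"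
      using ak by (simp only: powr_powr powr_one)
    ultimately show ?thesis
      using c p by (simp only: C_def powr_mult)
  qed
  show ?thesis
  proof (rule bigoI[of _ C])
    show "\<forall>\<^sub>F k in sequentially. norm (a k) \<le> C * norm (real k powr (- (1 / (p - 1))))"
      using eventually_ge_at_top[of 2] by eventually_elim (use bound nn in auto)
  qed
qed

section \<open>Invariants of a single run near the minimizer\<close>

locale plk_ball = tangent_majorized \<phi> g \<eta> for \<phi> g :: "real \<Rightarrow> real" and \<eta> +
  fixes f :: "'a::{real_inner, banach} \<Rightarrow> real" and G :: "'a \<Rightarrow> 'a" and xbar :: 'a
    and \<rho> L :: real
  assumes rho: "0 < \<rho>" and L: "0 < L"
    and grad: "\<forall>x\<in>ball xbar \<rho>. GDERIV f x :> G x"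
    and lip: "\<forall>x\<in>ball xbar \<rho>. \<forall>y\<in>ball xbar \<rho>. norm (G x - G y) \<le> L * norm (x - y)"
    and minimal: "\<And>x. x \<in> ball xbar \<rho> \<Longrightarrow> f xbar \<le> f x"
    and plk: "\<And>x. x \<in> ball xbar \<rho> \<Longrightarrow> f xbar < f x \<Longrightarrow> f x < f xbar + \<eta> \<Longrightarrow>
                1 \<le> g (f x - f xbar) * norm (G x)"
begin

lemma gradient_center: "G xbar = 0"
  using gradient_zero_at_minimum[OF bspec[OF grad] rho] minimal rho by simp

end

text \<open>The factor \<open>24 / \<epsilon>\<close> is the constant \<open>K\<close> below, so the
  last assumption keeps the length of the whole path within \<open>\<rho> / 8\<close>; the factor
  \<open>1 + C\<close> leaves room for the extrapolated points.\<close>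

locale egm_run = plk_ball \<phi> g \<eta> f G xbar \<rho> L
  for \<phi> g :: "real \<Rightarrow> real" and \<eta> and f :: "'a::{real_inner, banach} \<Rightarrow> real" and G xbar \<rho> L +
  fixes \<nu> B C \<epsilon> \<tau>1 \<tau>2 :: real and \<beta> \<gamma> :: "nat \<Rightarrow> real" and x :: "nat \<Rightarrow> 'a"
  assumes nu: "0 < \<nu>" "\<nu> < 1"
    and eps: "0 < \<epsilon>" "8 * \<epsilon> \<le> 1 - \<nu> - B\<^sup>2"
    and tau1: "0 < \<tau>1" "\<tau>1 \<le> 1" "\<tau>1 * (L * (1 + C)) \<le> \<epsilon>"
    and tau2: "0 \<le> \<tau>2" "\<tau>2 \<le> \<nu> / (L * (\<nu> + 1))"
    and BC: "0 \<le> B" "B \<le> C"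
    and beta: "\<And>k. k \<ge> 1 \<Longrightarrow> 0 \<le> \<beta> k" "\<And>k. k \<ge> 1 \<Longrightarrow> \<beta> k \<le> B"
    and gamma: "\<And>k. k \<ge> 1 \<Longrightarrow> 0 \<le> \<gamma> k" "\<And>k. k \<ge> 1 \<Longrightarrow> \<gamma> k \<le> C"
    and egm: "EGm_sequence G \<beta> \<gamma> \<tau>1 \<tau>2 x"
    and start: "x 1 \<in> ball xbar (\<rho> / 8)" "f (x 1) - f xbar < \<eta>"
      "24 / \<epsilon> * sqrt_regularization \<phi> (f (x 1) - f xbar) * (1 + C) \<le> \<rho> / 8"
begin

definition "\<kappa> = B\<^sup>2 + 2 * \<epsilon>"
definition "d k = x k - x (k - 1)"
definition "D k = norm (d k) + norm (d (k + 1))"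
definition "W k = f (x k) - f xbar + \<kappa> / (2 * \<tau>1) * (norm (d k))\<^sup>2"
definition "K = 24 / \<epsilon>"
definition "len k = (\<Sum>j=1..k. norm (d j))"

text \<open>The induction invariant: the length already travelled and the length that the remaining
  energy can still pay for stay together within the initial budget.\<close>

definition "controlled k \<longleftrightarrow> x k \<in> ball xbar \<rho> \<and> norm (x k - x 1) \<le> len k \<and>
  len k + K * \<Psi> (W k) \<le> K * \<Psi> (W 1) \<and> W k \<le> W 1"

lemma x0: "x 0 = x 1" and x_step: "k \<ge> 1 \<Longrightarrow>
    d (k + 1) = \<beta> k *\<^sub>R d k - \<tau>1 *\<^sub>R G (x k + \<gamma> k *\<^sub>R d k - \<tau>2 *\<^sub>R G (x k + \<gamma> k *\<^sub>R d k))"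
  using egm by (auto simp: EGm_sequence_def extrapolate_def d_def)

lemma extrapolate_d: "extrapolate c x k = x k + c k *\<^sub>R d k"
  by (simp add: extrapolate_def d_def)

lemma x_Suc: "x (Suc k) = x k + d (Suc k)"
  by (simp add: d_def)

lemma d1: "d (Suc 0) = 0" using x0 by (simp add: d_def)

lemma K_pos: "0 < K" using eps by (simp add: K_def)

lemma D_nonneg: "0 \<le> D k" by (simp add: D_def)

lemma eps_le: "\<epsilon> \<le> 1 / 8"
proof -
  have "0 \<le> B\<^sup>2" by simp
  then show ?thesis using eps(2) nu by linarith
qed

lemma kappa: "0 < \<kappa>" "\<kappa> \<le> 2"
proof -
  have "0 \<le> B\<^sup>2" by simp
  then show "0 < \<kappa>" "\<kappa> \<le> 2" using eps nu by (auto simp: \<kappa>_def intro: add_nonneg_pos)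
qed

lemma W1: "W (Suc 0) = f (x (Suc 0)) - f xbar" by (simp add: W_def d1)

lemma x1_ball: "x 1 \<in> ball xbar \<rho>" using start(1) rho by (auto simp: dist_norm)

lemma f_le_W: "f (x k) - f xbar \<le> W k" using kappa tau1 by (simp add: W_def)

lemma W_nonneg: "x k \<in> ball xbar \<rho> \<Longrightarrow> 0 \<le> W k"
  using f_le_W[of k] minimal[of "x k"] by simp

lemma W1_bounds: "0 \<le> W 1" "W 1 < \<eta>" using W_nonneg[OF x1_ball] start(2) W1 by auto

lemma len_budget: "(1 + C) * (K * \<Psi> (W 1)) \<le> \<rho> / 8"
  using start(3) by (simp add: K_def W1 algebra_simps)

lemma len_bound:
  assumes "controlled k" shows "len k \<le> K * \<Psi> (W 1)" "(1 + C) * len k \<le> \<rho> / 8"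
proof -
  have "0 \<le> \<Psi> (W k)" using assms W_nonneg W1_bounds by (intro reg_nonneg) (auto simp: controlled_def)
  then have "0 \<le> K * \<Psi> (W k)" using K_pos by simp
  then show 1: "len k \<le> K * \<Psi> (W 1)" using assms by (simp add: controlled_def)
  then show "(1 + C) * len k \<le> \<rho> / 8"
    using mult_left_mono[OF 1, of "1 + C"] len_budget BC by linarith
qed

lemma d_le_len: "k \<ge> 1 \<Longrightarrow> norm (d k) \<le> len k"
  unfolding len_def by (rule member_le_sum) auto

text \<open>The distance of the start from \<open>xbar\<close> and the term
  \<open>(1 + C) * len k\<close> account for \<open>\<rho> / 8\<close> each.\<close>

lemma extrapolate_near:
  assumes "controlled k" "k \<ge> 1" and c: "0 \<le> c" "c \<le> C"
  shows "norm (x k + c *\<^sub>R d k - xbar) < \<rho> / 4"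
proof -
  have l: "0 \<le> len k" by (simp add: len_def sum_nonneg)
  have "x k + c *\<^sub>R d k - xbar = (x 1 - xbar) + (x k - x 1) + c *\<^sub>R d k" by simp
  also have "norm \<dots> \<le> norm (x 1 - xbar) + norm (x k - x 1) + c * norm (d k)"
    using c by (metis (no_types) norm_triangle_le norm_triangle_mono norm_scaleR abs_of_nonneg order_refl)
  also have "\<dots> \<le> norm (x 1 - xbar) + len k + C * len k"
    using assms(1) d_le_len[OF assms(2)] c l by (intro add_mono mult_mono) (auto simp: controlled_def)
  also have "\<dots> < \<rho> / 4"
    using len_bound(2)[OF assms(1)] start(1) by (simp add: dist_norm norm_minus_commute algebra_simps)
  finally show ?thesis .
qed

text \<open>The next iterate must be located before any descent estimate is available. Since
  \<open>G xbar = 0\<close>, gradients are at most \<open>L\<close> times the distance to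
  \<open>xbar\<close>. With \<open>\<tau>2 L \<le> 1\<close> the inner step leads from radius
  \<open>\<rho> / 4\<close> to at most \<open>\<rho> / 2\<close>; with
  \<open>\<tau>1 L \<le> 1\<close> the outer one adds at most \<open>\<rho> / 2\<close> to the
  radius \<open>\<rho> / 4\<close> of the inertial point.\<close>

lemma step_points:
  assumes "controlled k" "k \<ge> 1"
  shows "x k + \<beta> k *\<^sub>R d k \<in> ball xbar \<rho>" "x k + \<gamma> k *\<^sub>R d k \<in> ball xbar \<rho>"
    "x k + \<gamma> k *\<^sub>R d k - \<tau>2 *\<^sub>R G (x k + \<gamma> k *\<^sub>R d k) \<in> ball xbar \<rho>"
    "x k + d (k + 1) \<in> ball xbar \<rho>"
proof -
  define e y where "e = x k + \<gamma> k *\<^sub>R d k" and "y = e - \<tau>2 *\<^sub>R G e"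
  have in_near: "norm (x k + \<beta> k *\<^sub>R d k - xbar) < \<rho> / 4"
    using beta[OF assms(2)] BC by (intro extrapolate_near assms) auto
  have e_near: "norm (e - xbar) < \<rho> / 4"
    unfolding e_def using gamma[OF assms(2)] by (intro extrapolate_near assms) auto
  have eb: "e \<in> ball xbar \<rho>" using e_near rho by (simp add: dist_norm norm_minus_commute)
  show "x k + \<beta> k *\<^sub>R d k \<in> ball xbar \<rho>"
    using in_near rho by (simp add: dist_norm norm_minus_commute)
  show "x k + \<gamma> k *\<^sub>R d k \<in> ball xbar \<rho>" using eb by (simp add: e_def)
  have lipc: "norm (G z) \<le> L * norm (z - xbar)" if "z \<in> ball xbar \<rho>" for z
    using bspec[OF bspec[OF lip that], of xbar] rho gradient_center by simp
  have "\<tau>2 * L \<le> \<tau>2 * (L * (\<nu> + 1))" using tau2(1) L nu by (intro mult_left_mono) auto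
  also have "\<dots> \<le> \<nu>" using tau2(2) L nu by (subst (asm) pos_le_divide_eq) auto
  finally have "\<tau>2 * L \<le> 1" using nu by simp
  then have t2: "\<tau>2 * L * norm (e - xbar) \<le> 1 * norm (e - xbar)" by (intro mult_right_mono) auto
  have "norm (y - xbar) \<le> norm (e - xbar) + norm (\<tau>2 *\<^sub>R G e)"
    using norm_triangle_ineq4[of "e - xbar" "\<tau>2 *\<^sub>R G e"] by (simp add: y_def algebra_simps)
  also have "norm (\<tau>2 *\<^sub>R G e) \<le> \<tau>2 * (L * norm (e - xbar))"
    using mult_left_mono[OF lipc[OF eb], of \<tau>2] tau2 by simp
  finally have y_near: "norm (y - xbar) < \<rho> / 2" using t2 e_near by (simp add: mult.assoc)
  then have yb: "y \<in> ball xbar \<rho>" using rho by (simp add: dist_norm norm_minus_commute)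
  then show "x k + \<gamma> k *\<^sub>R d k - \<tau>2 *\<^sub>R G (x k + \<gamma> k *\<^sub>R d k) \<in> ball xbar \<rho>"
    by (simp add: y_def e_def)
  have "\<tau>1 * L \<le> \<tau>1 * (L * (1 + C))" using tau1 L BC by (intro mult_left_mono) auto
  then have "\<tau>1 * L \<le> 1" using tau1(3) eps_le by linarith
  then have t1: "\<tau>1 * L * norm (y - xbar) \<le> 1 * norm (y - xbar)" by (intro mult_right_mono) auto
  have "x k + d (k + 1) - xbar = (x k + \<beta> k *\<^sub>R d k - xbar) - \<tau>1 *\<^sub>R G y"
    using x_step[OF assms(2)] by (simp add: y_def e_def)
  also have "norm \<dots> \<le> norm (x k + \<beta> k *\<^sub>R d k - xbar) + norm (\<tau>1 *\<^sub>R G y)"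
    by (rule norm_triangle_ineq4)
  also have "norm (\<tau>1 *\<^sub>R G y) \<le> \<tau>1 * (L * norm (y - xbar))"
    using mult_left_mono[OF lipc[OF yb], of \<tau>1] tau1 by simp
  finally have "norm (x k + d (k + 1) - xbar) < \<rho>" using t1 y_near in_near rho by (simp add: mult.assoc)
  then show "x k + d (k + 1) \<in> ball xbar \<rho>" by (simp add: dist_norm norm_minus_commute)
qed

lemma step_estimates:
  assumes "controlled k" "k \<ge> 1"
  shows "W (k + 1) + \<epsilon> / (4 * \<tau>1) * (D k)\<^sup>2 \<le> W k" and "norm (G (x k)) \<le> 3 / \<tau>1 * D k"
proof -
  note step = extragradient_lyapunov_step[OF convex_ball grad lip L nu tau1(1,3) tau2
      beta[OF assms(2)] gamma[OF assms(2)] eps \<kappa>_def _ step_points(2,3,4)[OF assms]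
      x_step[OF assms(2)]]
  have "x k \<in> ball xbar \<rho>" using assms by (simp add: controlled_def)
  from step[OF this]
  show "W (k + 1) + \<epsilon> / (4 * \<tau>1) * (D k)\<^sup>2 \<le> W k" "norm (G (x k)) \<le> 3 / \<tau>1 * D k"
    by (simp_all add: W_def D_def x_Suc[symmetric])
qed

text \<open>This is \<open>reg_increase\<close> with \<open>s\<close> the function gap,
  \<open>\<delta>\<close> the dissipated energy and \<open>l\<close> the bound
  \<open>3 D k / \<tau>1\<close> on the gradient norm. The PLK inequality gives the slope
  \<open>1 / l\<close> at \<open>s\<close>, and the kinetic part of \<open>W k\<close> is at most
  \<open>l^2\<close>.\<close>

lemma step_length:
  assumes "controlled k" "k \<ge> 1"
  shows "D k \<le> K * (\<Psi> (W k) - \<Psi> (W (k + 1)))"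
proof -
  have xk: "x k \<in> ball xbar \<rho>" and Wk: "W k \<le> W 1" using assms(1) by (auto simp: controlled_def)
  have x': "x (k + 1) \<in> ball xbar \<rho>" using step_points(4)[OF assms] by (simp add: x_Suc)
  have W': "0 \<le> W (k + 1)" using W_nonneg[OF x'] .
  have Wk\<eta>: "W k < \<eta>" using Wk W1_bounds by simp
  note est = step_estimates[OF assms]
  define \<delta> where "\<delta> = \<epsilon> / (4 * \<tau>1) * (D k)\<^sup>2"
  have \<delta>: "0 \<le> \<delta>" "W (k + 1) \<le> W k - \<delta>" using est eps tau1 by (auto simp: \<delta>_def)
  have mono: "\<Psi> (W (k + 1)) \<le> \<Psi> (W k - \<delta>)" using \<delta> W' Wk\<eta> by (intro reg_mono) auto
  show ?thesis
  proof (cases "D k = 0")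
    case True
    then show ?thesis using mono K_pos by (simp add: \<delta>_def)
  next
    case False
    then have Dk: "0 < D k" using D_nonneg[of k] by simp
    define l where "l = 3 / \<tau>1 * D k"
    have l: "0 < l" using Dk tau1 by (simp add: l_def)
    \<comment> \<open>Energies scale like \<open>D^2 / \<tau>1\<close> and \<open>l^2\<close> like
      \<open>D^2 / \<tau>1^2\<close>; the condition \<open>\<tau>1 \<le> 1\<close> makes them
      comparable with constants free of \<open>\<tau>1\<close>.\<close>
    have D2: "(D k)\<^sup>2 / \<tau>1 \<le> (D k)\<^sup>2 / \<tau>1\<^sup>2"
      using tau1 by (intro divide_left_mono) (auto simp: power2_eq_square mult_left_le)
    have D2_nonneg: "0 \<le> (D k)\<^sup>2 / \<tau>1\<^sup>2" by simp
    have l2: "l\<^sup>2 = 9 * ((D k)\<^sup>2 / \<tau>1\<^sup>2)" by (simp add: l_def power_mult_distrib power_divide)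
    have "\<delta> \<le> (D k)\<^sup>2 / \<tau>1"
      using eps_le mult_right_mono[of "\<epsilon> / 4" 1 "(D k)\<^sup>2 / \<tau>1"] tau1 by (simp add: \<delta>_def)
    then have \<delta>l: "\<delta> \<le> l\<^sup>2" using D2 D2_nonneg unfolding l2 by linarith
    have dD: "(norm (d k))\<^sup>2 \<le> (D k)\<^sup>2" by (intro power_mono) (auto simp: D_def)
    have "\<kappa> / (2 * \<tau>1) * (norm (d k))\<^sup>2 \<le> 1 / \<tau>1 * (D k)\<^sup>2"
      using kappa tau1 dD by (intro mult_mono) (auto simp: field_simps)
    then have Wl: "W k \<le> (f (x k) - f xbar) + l\<^sup>2"
      using D2 D2_nonneg unfolding l2 W_def by (simp only: mult_1 times_divide_eq_left)
    have s\<eta>: "f (x k) - f xbar < \<eta>" using f_le_W[of k] Wk\<eta> by simp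
    have sl: "1 \<le> g (f (x k) - f xbar) * l" if s: "0 < f (x k) - f xbar"
    proof -
      have "1 \<le> g (f (x k) - f xbar) * norm (G (x k))" using plk[OF xk] s s\<eta> by simp
      also have "\<dots> \<le> g (f (x k) - f xbar) * l"
        using est(2) slope_pos[OF s s\<eta>] by (intro mult_left_mono) (auto simp: l_def)
      finally show ?thesis .
    qed
    have "\<Psi> (W k - \<delta>) + \<delta> / (2 * l) \<le> \<Psi> (W k)"
      using \<delta> W' \<delta>l l Wl Wk\<eta> s\<eta> sl by (intro reg_increase[of _ _ \<delta> l "f (x k) - f xbar"]) auto
    \<comment> \<open>The quotient of \<open>\<epsilon> D^2 / (4 \<tau>1)\<close> by
      \<open>6 D / \<tau>1\<close> is \<open>\<epsilon> D / 24\<close>: the stepsize cancels, and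
      this fixes \<open>K\<close>.\<close>
    moreover have "\<delta> / (2 * l) = D k / K"
      using Dk tau1 eps by (simp add: \<delta>_def l_def K_def field_simps power2_eq_square)
    ultimately have "D k / K \<le> \<Psi> (W k) - \<Psi> (W (k + 1))" using mono by simp
    then show ?thesis using K_pos by (simp add: field_simps)
  qed
qed

lemma controlled_all: "k \<ge> 1 \<Longrightarrow> controlled k"
proof (induction k rule: dec_induct)
  case base
  show ?case using x1_ball by (simp add: controlled_def len_def d1)
next
  case (step k)
  then have k: "k \<ge> 1" and I: "controlled k" by auto
  have "x (k + 1) \<in> ball xbar \<rho>" using step_points(4)[OF I k] by (simp add: x_Suc)
  moreover have len: "len (k + 1) = len k + norm (d (k + 1))" by (simp add: len_def)
  moreover have "norm (x (k + 1) - x 1) \<le> len (k + 1)"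
  proof -
    have "x (k + 1) - x 1 = (x k - x 1) + d (k + 1)" by (simp add: d_def)
    also have "norm \<dots> \<le> norm (x k - x 1) + norm (d (k + 1))" by (rule norm_triangle_ineq)
    also have "\<dots> \<le> len (k + 1)" using I len by (simp add: controlled_def)
    finally show ?thesis .
  qed
  moreover have "len (k + 1) + K * \<Psi> (W (k + 1)) \<le> K * \<Psi> (W 1)"
  proof -
    have "norm (d (k + 1)) \<le> D k" by (simp add: D_def)
    then have "norm (d (k + 1)) \<le> K * \<Psi> (W k) - K * \<Psi> (W (k + 1))"
      using step_length[OF I k] by (simp add: right_diff_distrib)
    then show ?thesis using I len by (simp add: controlled_def)
  qed
  moreover have "W (k + 1) \<le> W 1"
  proof -
    have "0 \<le> \<epsilon> / (4 * \<tau>1) * (D k)\<^sup>2" using eps tau1 by simp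
    then show ?thesis using step_estimates(1)[OF I k] I by (simp add: controlled_def)
  qed
  ultimately show ?case by (simp add: controlled_def)
qed

section \<open>Convergence of the iterates and properties of the limit\<close>

lemma in_ball: "x k \<in> ball xbar \<rho>"
  using controlled_all[of k] x0 x1_ball by (cases "k = 0") (auto simp: controlled_def)

lemma W_bounds: "k \<ge> 1 \<Longrightarrow> W k \<le> W 1" "k \<ge> 1 \<Longrightarrow> W k < \<eta>" "0 \<le> W k"
  using controlled_all[of k] W1_bounds W_nonneg in_ball by (auto simp: controlled_def)

lemma extrapolate_in_ball:
  "k \<ge> 1 \<Longrightarrow> extrapolate \<beta> x k \<in> ball xbar \<rho> \<and> extrapolate \<gamma> x k \<in> ball xbar \<rho>"
  using step_points controlled_all by (simp add: extrapolate_d)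

lemma tail_length: "k \<le> m \<Longrightarrow> 1 \<le> k \<Longrightarrow> norm (x m - x k) \<le> K * (\<Psi> (W k) - \<Psi> (W m))"
proof (induction rule: dec_induct)
  case (step m)
  then have m: "m \<ge> 1" by simp
  have "x (m + 1) - x k = (x m - x k) + d (m + 1)" by (simp add: d_def)
  also have "norm \<dots> \<le> norm (x m - x k) + norm (d (m + 1))" by (rule norm_triangle_ineq)
  also have "\<dots> \<le> K * (\<Psi> (W k) - \<Psi> (W m)) + K * (\<Psi> (W m) - \<Psi> (W (m + 1)))"
    using step_length[OF controlled_all[OF m] m] step by (intro add_mono) (auto simp: D_def intro: order_trans[rotated])
  finally show ?case by (simp add: algebra_simps)
qed auto

lemma x_convergent: "convergent x"
proof -
  have "summable (\<lambda>n. norm (d (n + 1)))"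
  proof (rule summableI_nonneg_bounded)
    fix n
    have "(\<Sum>i<n. norm (d (i + 1))) = len n"
      unfolding len_def by (induction n) auto
    also have "\<dots> \<le> K * \<Psi> (W 1)"
      using len_bound(1)[OF controlled_all[of n]] K_pos reg_nonneg[OF W1_bounds]
      by (cases "n = 0") (auto simp: len_def)
    finally show "(\<Sum>i<n. norm (d (i + 1))) \<le> K * \<Psi> (W 1)" .
  qed simp
  then have "summable (\<lambda>n. d (n + 1))" by (rule summable_norm_cancel)
  then have "(\<lambda>n. \<Sum>i<n. d (i + 1)) \<longlonglongrightarrow> (\<Sum>n. d (n + 1))" by (rule summable_LIMSEQ)
  moreover have "(\<Sum>i<n. d (i + 1)) = x n - x 0" for n
    by (simp add: d_def sum_lessThan_telescope)
  ultimately have "(\<lambda>n. (x n - x 0) + x 0) \<longlonglongrightarrow> (\<Sum>n. d (n + 1)) + x 0"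
    by (intro tendsto_add) auto
  then show ?thesis by (auto simp: convergent_def)
qed

definition "xt = lim x"

lemma x_lim: "x \<longlonglongrightarrow> xt"
  unfolding xt_def using x_convergent by (simp add: convergent_LIMSEQ_iff)

lemma xt_dist: assumes "k \<ge> 1" shows "norm (x k - xt) \<le> K * \<Psi> (W k)"
proof (rule LIMSEQ_le_const2)
  show "(\<lambda>m. norm (x k - x m)) \<longlonglongrightarrow> norm (x k - xt)" by (intro tendsto_intros x_lim)
  have "norm (x k - x m) \<le> K * \<Psi> (W k)" if "m \<ge> k" for m
  proof -
    have "0 \<le> \<Psi> (W m)" using W_bounds[of m] assms that by (intro reg_nonneg) auto
    then have "0 \<le> K * \<Psi> (W m)" using K_pos by simp
    then show ?thesis
      using tail_length[OF that assms] by (simp add: norm_minus_commute right_diff_distrib)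
  qed
  then show "\<exists>N. \<forall>m\<ge>N. norm (x k - x m) \<le> K * \<Psi> (W k)" by blast
qed

lemma xt_ball: "xt \<in> ball xbar \<rho>"
proof -
  have "K * \<Psi> (W 1) \<le> (1 + C) * (K * \<Psi> (W 1))"
    using mult_right_mono[of 1 "1 + C" "K * \<Psi> (W 1)"] K_pos reg_nonneg[OF W1_bounds] BC by simp
  then have "norm (x 1 - xt) \<le> \<rho> / 8" using xt_dist[of 1] len_budget by simp
  moreover have "dist xbar xt \<le> dist xbar (x 1) + norm (x 1 - xt)"
    using dist_triangle[of xbar xt "x 1"] by (simp add: dist_norm)
  ultimately show ?thesis using start(1) rho by simp
qed

lemma d_lim: "d \<longlonglongrightarrow> 0"
proof (rule LIMSEQ_imp_Suc)
  have "(\<lambda>k. x (Suc k) - x k) \<longlonglongrightarrow> xt - xt" by (intro tendsto_diff LIMSEQ_Suc x_lim)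
  then show "(\<lambda>k. d (Suc k)) \<longlonglongrightarrow> 0" by (simp add: d_def)
qed

lemma extrapolate_lim:
  assumes "\<And>k. k \<ge> 1 \<Longrightarrow> 0 \<le> c k" "\<And>k. k \<ge> 1 \<Longrightarrow> c k \<le> C"
  shows "extrapolate c x \<longlonglongrightarrow> xt"
proof -
  have "(\<lambda>k. c k *\<^sub>R d k) \<longlonglongrightarrow> 0"
  proof (rule Lim_null_comparison)
    show "\<forall>\<^sub>F k in sequentially. norm (c k *\<^sub>R d k) \<le> C * norm (d k)"
      using eventually_ge_at_top[of 1]
      by eventually_elim (use assms in \<open>auto intro!: mult_right_mono\<close>)
    show "(\<lambda>k. C * norm (d k)) \<longlonglongrightarrow> 0"
      using tendsto_mult_right_zero[OF tendsto_norm_zero[OF d_lim]] .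
  qed
  from tendsto_add[OF x_lim this] show ?thesis by (simp add: extrapolate_d[abs_def])
qed

text \<open>The gradients at the iterates are dominated by the step lengths, which tend to
  zero.\<close>

lemma gradient_lim: "G xt = 0"
proof -
  have "(\<lambda>k. 3 / \<tau>1 * D k + L * norm (x k - xt)) \<longlonglongrightarrow> 3 / \<tau>1 * (norm (0::'a) + norm (0::'a)) + L * norm (xt - xt)"
    unfolding D_def using LIMSEQ_Suc[OF d_lim] by (intro tendsto_intros d_lim x_lim) simp
  moreover have "norm (G xt) \<le> 3 / \<tau>1 * D k + L * norm (x k - xt)" if "k \<ge> 1" for k
  proof -
    have "norm (G xt) \<le> norm (G (x k)) + norm (G (x k) - G xt)" by norm
    then show ?thesis
      using step_estimates(2)[OF controlled_all[OF that] that] bspec[OF bspec[OF lip in_ball[of k]] xt_ball] by linarith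
  qed
  ultimately have "norm (G xt) \<le> 3 / \<tau>1 * (norm (0::'a) + norm (0::'a)) + L * norm (xt - xt)"
    by (intro LIMSEQ_le_const) auto
  then show ?thesis by simp
qed

text \<open>The limit is a critical point, and its value exceeds \<open>f xbar\<close> by at most
  \<open>W 1 < \<eta>\<close>. The PLK inequality allows no critical point with a value strictly
  between \<open>f xbar\<close> and \<open>f xbar + \<eta>\<close>.\<close>

lemma f_lim: "f xt = f xbar"
proof (rule ccontr)
  assume "f xt \<noteq> f xbar"
  then have pos: "f xbar < f xt" using minimal[OF xt_ball] by simp
  have "isCont f xt"
    using bspec[OF grad xt_ball] has_derivative_continuous unfolding gderiv_def by blast
  then have "(\<lambda>k. f (x k)) \<longlonglongrightarrow> f xt" using x_lim by (rule isCont_tendsto_compose)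
  moreover have "f (x k) \<le> f xbar + W 1" if "k \<ge> 1" for k
    using f_le_W[of k] W_bounds(1)[OF that] by simp
  ultimately have "f xt \<le> f xbar + W 1" by (intro LIMSEQ_le_const2) auto
  then have "1 \<le> g (f xt - f xbar) * norm (G xt)"
    using W1_bounds pos by (intro plk xt_ball) auto
  then show False by (simp add: gradient_lim)
qed

lemma gradient_dist: "norm (G (x k)) \<le> L * norm (x k - xt)"
  using bspec[OF bspec[OF lip in_ball[of k]] xt_ball] by (simp add: gradient_lim)

text \<open>The descent lemma at the critical point \<open>xt\<close> loses its linear term; this is
  why values converge at the square of the rate of the iterates.\<close>

lemma f_dist: "norm (f (x k) - f xt) \<le> L / 2 * (norm (x k - xt))\<^sup>2"
  using smooth_upper_bound[OF convex_ball xt_ball in_ball grad lip, of k] minimal[OF in_ball[of k]]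
  by (simp add: gradient_lim f_lim)

section \<open>Convergence rates for power functions\<close>

context
  fixes M A q :: real
  assumes M: "0 < M" and A: "0 < A" and q: "1 / 2 \<le> q" "q < 1"
    and phi_power: "\<And>s. 0 \<le> s \<Longrightarrow> s < \<eta> \<Longrightarrow> \<phi> s \<le> M * s powr (1 - q)"
    and slope_power: "\<And>s. 0 < s \<Longrightarrow> s < \<eta> \<Longrightarrow> g s * s powr q \<le> A"
begin

text \<open>For \<open>q \<ge> 1/2\<close> the root term in \<open>reg_le\<close> is dominated by
  \<open>W k powr (1 - q)\<close>: the surplus power \<open>q - 1/2\<close> is nonnegative and
  \<open>W k \<le> W 1\<close>.\<close>

lemma xt_dist_power:
  "\<exists>K'>0. \<forall>k\<ge>1. norm (x k - xt) \<le> K' * W k powr (1 - q)"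
proof (intro exI conjI allI impI)
  let ?K' = "K * (M + 2 * W 1 powr (q - 1 / 2))"
  show "0 < ?K'" using K_pos M by (intro mult_pos_pos add_pos_nonneg) auto
  fix k :: nat assume k: "k \<ge> 1"
  note W = W_bounds(1,2)[OF k] W_bounds(3)[of k]
  have "sqrt (W k) = W k powr (1 - q) * W k powr (q - 1 / 2)"
    using W by (simp add: powr_half_sqrt flip: powr_add)
  also have "\<dots> \<le> W k powr (1 - q) * W 1 powr (q - 1 / 2)"
    using W q by (intro mult_left_mono powr_mono2) auto
  finally have "\<Psi> (W k) \<le> M * W k powr (1 - q) + 2 * (W k powr (1 - q) * W 1 powr (q - 1 / 2))"
    using reg_le[OF W(3,2)] phi_power[OF W(3,2)] by simp
  also have "\<dots> = (M + 2 * W 1 powr (q - 1 / 2)) * W k powr (1 - q)" by (simp add: algebra_simps)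
  finally have "K * \<Psi> (W k) \<le> ?K' * W k powr (1 - q)"
    using K_pos by (simp add: mult.assoc)
  then show "norm (x k - xt) \<le> ?K' * W k powr (1 - q)" using xt_dist[OF k] by simp
qed

text \<open>The power \<open>2 q\<close> of both parts of the energy is \<open>O((D k)^2)\<close>,
  hence bounded by the decrease. For the function gap the PLK inequality reads
  \<open>s^q \<le> A |G (x k)|\<close>. The kinetic part is itself a multiple of a square, and the
  surplus power \<open>2 q - 1 \<ge> 0\<close> costs only a factor bounded through
  \<open>W 1\<close>. The constants may depend on \<open>\<tau>1\<close> here, as the rates are
  claimed for each run separately.\<close>

lemma W_decrease: "\<exists>c>0. \<forall>k\<ge>1. c * W k powr (2 * q) \<le> W k - W (k + 1)"
proof -
  define H E where "H = (3 / \<tau>1 * A)\<^sup>2 + \<kappa> / (2 * \<tau>1) * W 1 powr (2 * q - 1)"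
    and "E = 4 * H * (4 * \<tau>1 / \<epsilon>)"
  have H: "0 < H" using tau1 A kappa unfolding H_def
    by (intro add_pos_nonneg mult_nonneg_nonneg) auto
  have E: "0 < E" using H tau1 eps by (simp add: E_def)
  have "W k powr (2 * q) \<le> E * (W k - W (k + 1))" if k: "k \<ge> 1" for k
  proof -
    define s t where "s = f (x k) - f xbar" and "t = \<kappa> / (2 * \<tau>1) * (norm (d k))\<^sup>2"
    note W = W_bounds(1,2)[OF k] W_bounds(3)[of k]
    note est = step_estimates[OF controlled_all[OF k] k]
    have Wst: "W k = s + t" by (simp add: W_def s_def t_def)
    have s: "0 \<le> s" using minimal[OF in_ball[of k]] by (simp add: s_def)
    have t: "0 \<le> t" using kappa tau1 by (simp add: t_def)
    have "s powr q \<le> 3 / \<tau>1 * A * D k"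
    proof (cases "s = 0")
      case False
      then have s0: "0 < s" "s < \<eta>" using s t W Wst by auto
      have "1 \<le> g s * norm (G (x k))"
        using plk[OF in_ball[of k]] s0 by (simp add: s_def)
      then have "s powr q \<le> g s * norm (G (x k)) * s powr q"
        using mult_right_mono[of 1 _ "s powr q"] by simp
      also have "\<dots> = g s * s powr q * norm (G (x k))" by simp
      also have "\<dots> \<le> A * norm (G (x k))" using slope_power[OF s0] by (intro mult_right_mono) auto
      also have "\<dots> \<le> A * (3 / \<tau>1 * D k)" using est(2) A by (intro mult_left_mono) auto
      finally show ?thesis by (simp add: algebra_simps)
    qed (use tau1 A D_nonneg in auto)
    then have "(s powr q)\<^sup>2 \<le> (3 / \<tau>1 * A * D k)\<^sup>2" by (intro power_mono) auto
    moreover have "s powr (2 * q) = (s powr q)\<^sup>2" by (simp add: power2_eq_square flip: powr_add)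
    ultimately have sq: "s powr (2 * q) \<le> (3 / \<tau>1 * A)\<^sup>2 * (D k)\<^sup>2"
      by (simp only: power_mult_distrib)
    have "t powr (2 * q) = t * t powr (2 * q - 1)"
      using powr_add[of t 1 "2 * q - 1"] t by simp
    also have "\<dots> \<le> (\<kappa> / (2 * \<tau>1) * (D k)\<^sup>2) * W 1 powr (2 * q - 1)"
    proof (rule mult_mono)
      show "t \<le> \<kappa> / (2 * \<tau>1) * (D k)\<^sup>2"
        unfolding t_def using kappa tau1 by (intro mult_left_mono power_mono) (auto simp: D_def)
      show "t powr (2 * q - 1) \<le> W 1 powr (2 * q - 1)"
        using t s W Wst q by (intro powr_mono2) auto
    qed (use kappa tau1 in auto)
    finally have tq: "t powr (2 * q) \<le> \<kappa> / (2 * \<tau>1) * W 1 powr (2 * q - 1) * (D k)\<^sup>2"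
      by (simp add: algebra_simps)
    \<comment> \<open>The sum is at most twice the maximum, and \<open>2 q \<le> 2\<close> bounds
      the resulting factor by 4.\<close>
    have "W k powr (2 * q) \<le> (2 * max s t) powr (2 * q)"
      using W Wst q by (intro powr_mono2) auto
    also have "\<dots> = 2 powr (2 * q) * max s t powr (2 * q)" using s by (simp add: powr_mult)
    also have "\<dots> \<le> 4 * (s powr (2 * q) + t powr (2 * q))"
    proof (rule mult_mono)
      have "2 powr (2 * q) \<le> 2 powr (2::real)" using q by (intro powr_mono) auto
      then show "2 powr (2 * q) \<le> (4::real)" by simp
    qed (auto simp: max_def)
    also have "\<dots> \<le> 4 * (H * (D k)\<^sup>2)"
      unfolding H_def distrib_right by (rule mult_left_mono[OF add_mono[OF sq tq]]) simp
    also have "\<dots> = E * (\<epsilon> / (4 * \<tau>1) * (D k)\<^sup>2)"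
      using tau1 eps by (simp add: E_def)
    also have "\<dots> \<le> E * (W k - W (k + 1))" using E est(1) by (intro mult_left_mono) auto
    finally show ?thesis .
  qed
  then have "1 / E * W k powr (2 * q) \<le> W k - W (k + 1)" if "k \<ge> 1" for k
    using that E by (simp add: field_simps)
  then show ?thesis using E by (intro exI[of _ "1 / E"]) auto
qed

lemma linear_rate:
  assumes "q = 1 / 2"
  shows "\<exists>\<mu>. 0 < \<mu> \<and> \<mu> < 1 \<and> (\<lambda>k. norm (x k - xt)) \<in> O(\<lambda>k. \<mu> ^ k)"
proof -
  obtain c where c: "c > 0" "\<And>k. k \<ge> 1 \<Longrightarrow> c * W k powr (2 * q) \<le> W k - W (k + 1)"
    using W_decrease by blast
  obtain K' where K': "K' > 0" "\<And>k. k \<ge> 1 \<Longrightarrow> norm (x k - xt) \<le> K' * W k powr (1 - q)"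
    using xt_dist_power by blast
  \<comment> \<open>The minimum keeps the ratio \<open>m\<close> positive, which the prefactor
    \<open>W 1 / m\<close> requires.\<close>
  define m where "m = 1 - min c (1 / 2)"
  have m: "0 < m" "m < 1" using c by (auto simp: m_def)
  have W_step: "W (k + 1) \<le> m * W k" if k: "k \<ge> 1" for k
  proof -
    have "min c (1 / 2) * W k \<le> c * W k" using W_bounds(3) by (intro mult_right_mono) auto
    then show ?thesis using c(2)[OF k] W_bounds(3)[of k] assms by (simp add: m_def algebra_simps)
  qed
  have W_geom: "W k \<le> (W 1 / m) * m ^ k" if "k \<ge> 1" for k
    using that
  proof (induction k rule: dec_induct)
    case base
    then show ?case using m by simp
  next
    case (step k)
    have "W (Suc k) \<le> m * W k" using W_step[of k] step by simp
    also have "\<dots> \<le> m * ((W 1 / m) * m ^ k)" using step m by (intro mult_left_mono) auto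
    finally show ?case by simp
  qed
  have sq: "sqrt m ^ k = sqrt (m ^ k)" for k by (simp add: real_sqrt_power)
  have "norm (x k - xt) \<le> K' * sqrt (W 1 / m) * sqrt m ^ k" if k: "k \<ge> 1" for k
  proof -
    have "norm (x k - xt) \<le> K' * sqrt (W k)"
      using K'(2)[OF k] W_bounds(3)[of k] by (simp add: assms powr_half_sqrt)
    also have "\<dots> \<le> K' * sqrt ((W 1 / m) * m ^ k)"
      using W_geom[OF k] K'(1) by (intro mult_left_mono) auto
    finally show ?thesis by (simp only: real_sqrt_mult sq mult.assoc)
  qed
  then have "(\<lambda>k. norm (x k - xt)) \<in> O(\<lambda>k. sqrt m ^ k)"
    using m by (intro bigoI[of _ "K' * sqrt (W 1 / m)"] eventually_sequentiallyI[of 1]) auto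
  then show ?thesis using m by (intro exI[of _ "sqrt m"]) auto
qed

text \<open>The energy decays by \<open>power_decay_rate\<close> with exponent \<open>2 q\<close>;
  the distance to the limit is controlled by its power \<open>1 - q\<close>.\<close>

lemma sublinear_rate:
  assumes "1 / 2 < q"
  shows "(\<lambda>k. norm (x k - xt)) \<in> O(\<lambda>k. real k powr (- ((1 - q) / (2 * q - 1))))"
proof -
  obtain c where c: "c > 0" "\<And>k. k \<ge> 1 \<Longrightarrow> c * W k powr (2 * q) \<le> W k - W (k + 1)"
    using W_decrease by blast
  obtain K' where K': "K' > 0" "\<And>k. k \<ge> 1 \<Longrightarrow> norm (x k - xt) \<le> K' * W k powr (1 - q)"
    using xt_dist_power by blast
  have "W \<in> O(\<lambda>k. real k powr (- (1 / (2 * q - 1))))"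
    using c assms W_bounds(3) by (intro power_decay_rate[of W c "2 * q"]) auto
  then obtain a where a: "a > 0"
    "\<forall>\<^sub>F k in sequentially. norm (W k) \<le> a * norm (real k powr (- (1 / (2 * q - 1))))"
    by (rule landau_o.bigE)
  show ?thesis
  proof (rule bigoI[of _ "K' * a powr (1 - q)"])
    show "\<forall>\<^sub>F k in sequentially. norm (norm (x k - xt))
        \<le> K' * a powr (1 - q) * norm (real k powr (- ((1 - q) / (2 * q - 1))))"
      using a(2) eventually_ge_at_top[of 1]
    proof eventually_elim
      case (elim k)
      have "W k powr (1 - q) \<le> (a * real k powr (- (1 / (2 * q - 1)))) powr (1 - q)"
        using elim W_bounds(3)[of k] q by (intro powr_mono2) auto
      also have "\<dots> = a powr (1 - q) * real k powr (- ((1 - q) / (2 * q - 1)))"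
        using a(1) by (simp add: powr_mult powr_powr)
      finally have "K' * W k powr (1 - q) \<le> K' * (a powr (1 - q) * real k powr (- ((1 - q) / (2 * q - 1))))"
        using K'(1) by (intro mult_left_mono) auto
      then show ?case using K'(2)[OF elim(2)] by (simp add: mult.assoc)
    qed
  qed
qed

end

lemma gradient_rate:
  "(\<lambda>k. norm (x k - xt)) \<in> O(h) \<Longrightarrow> (\<lambda>k. norm (G (x k))) \<in> O(h)"
  by (rule landau_o.big.trans[rotated], assumption, rule bigoI[of _ L]) (simp add: gradient_dist)

lemma value_rate:
  assumes "(\<lambda>k. norm (x k - xt)) \<in> O(h)"
  shows "(\<lambda>k. f (x k) - f xt) \<in> O(\<lambda>k. (h k)\<^sup>2)"
proof (rule landau_o.big.trans)
  show "(\<lambda>k. f (x k) - f xt) \<in> O(\<lambda>k. (norm (x k - xt))\<^sup>2)"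
    by (rule bigoI[of _ "L / 2"], rule always_eventually) (use f_dist in auto)
  show "(\<lambda>k. (norm (x k - xt))\<^sup>2) \<in> O(\<lambda>k. (h k)\<^sup>2)"
    unfolding power2_eq_square using assms by (intro landau_o.big.mult)
qed

end

section \<open>Choice of the starting ball and assembly\<close>

lemma (in plk_ball) start_radius:
  assumes "0 < e" and "0 < \<eta>" and small: "\<exists>\<delta>>0. \<forall>t. 0 \<le> t \<and> t < \<delta> \<longrightarrow> \<phi> t < e / 2"
  obtains \<xi> where "0 < \<xi>" "\<xi> \<le> \<rho> / 8"
    "\<And>y. y \<in> ball xbar \<xi> \<Longrightarrow> f y - f xbar < \<eta> \<and> \<Psi> (f y - f xbar) \<le> e"
proof -
  obtain \<delta>1 where \<delta>1: "0 < \<delta>1" "\<And>t. 0 \<le> t \<Longrightarrow> t < \<delta>1 \<Longrightarrow> \<phi> t < e / 2"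
    using small by auto
  \<comment> \<open>One half of \<open>e\<close> is reserved for \<open>\<phi>\<close>, small near
    \<open>0\<close> since the jump is gone; the other half is for the root term, as gaps below
    \<open>(e / 4)^2\<close> give \<open>2 sqrt\<close> at most \<open>e / 2\<close>.\<close>
  define \<delta> where "\<delta> = min \<eta> (min \<delta>1 ((e / 4)\<^sup>2))"
  have \<delta>: "0 < \<delta>" using \<open>0 < e\<close> \<open>0 < \<eta>\<close> \<delta>1 by (simp add: \<delta>_def)
  have "isCont f xbar"
    using bspec[OF grad, of xbar] rho has_derivative_continuous unfolding gderiv_def by auto
  then obtain \<xi>0 where \<xi>0: "0 < \<xi>0" "\<And>y. dist y xbar < \<xi>0 \<Longrightarrow> dist (f y) (f xbar) < \<delta>"
    using \<delta> unfolding continuous_at_eps_delta by metis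
  show thesis
  proof (rule that[of "min \<xi>0 (\<rho> / 8)"])
    fix y assume y: "y \<in> ball xbar (min \<xi>0 (\<rho> / 8))"
    then have less: "f y - f xbar < \<delta>" using \<xi>0(2)[of y] by (auto simp: dist_real_def dist_commute)
    have nn: "0 \<le> f y - f xbar" using minimal[of y] y rho by simp
    have "\<Psi> (f y - f xbar) \<le> \<phi> (f y - f xbar) + 2 * sqrt (f y - f xbar)"
      using nn less by (intro reg_le) (auto simp: \<delta>_def)
    moreover have "sqrt (f y - f xbar) \<le> e / 4"
      using less \<open>0 < e\<close> by (intro real_le_lsqrt) (auto simp: \<delta>_def)
    moreover have "\<phi> (f y - f xbar) < e / 2" using \<delta>1(2) nn less by (simp add: \<delta>_def)
    ultimately show "f y - f xbar < \<eta> \<and> \<Psi> (f y - f xbar) \<le> e" using less by (simp add: \<delta>_def)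
  qed (use \<xi>0 rho in auto)
qed

theorem theorem4p2:
  fixes xbar :: "real ^ 'n"
    and r L \<nu> :: real
    and X :: "(real ^ 'n) set"
    and f :: "real ^ 'n \<Rightarrow> real"
    and G :: "real ^ 'n \<Rightarrow> real ^ 'n"
    and \<eta> :: ereal
    and \<psi> :: "real \<Rightarrow> real"
    and \<beta> \<gamma> :: "nat \<Rightarrow> real"
  assumes "r > 0" and "X = ball xbar r"
    and "\<forall>x\<in>X. GDERIV f x :> G x" and "continuous_on X G"
    and "L > 0" and "\<forall>x\<in>X. \<forall>y\<in>X. norm (G x - G y) \<le> L * norm (x - y)"
    and "local_minimizer_on X f xbar"
    and "PLK_condition X f G xbar \<eta> \<psi>"
    and "0 < \<nu>" and "\<nu> < 1"
    and "\<forall>k\<ge>1. \<beta> k \<ge> 0" and "\<forall>k\<ge>1. \<gamma> k \<ge> 0"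
    and "bdd_above (\<beta> ` {1..})" and "(SUP k\<in>{1..}. \<beta> k) < sqrt (1 - \<nu>)"
    and "bdd_above ((\<lambda>k. \<bar>\<beta> k - \<gamma> k\<bar>) ` {1..})"
  shows "\<exists>\<xi> T. 0 < \<xi> \<and> \<xi> \<le> r \<and> 0 < T \<and>
    (\<forall>x \<tau>1 \<tau>2.
       x 0 \<in> ball xbar \<xi> \<and> 0 < \<tau>1 \<and> \<tau>1 \<le> T \<and> 0 \<le> \<tau>2 \<and> \<tau>2 \<le> \<nu> / (L * (\<nu> + 1)) \<and>
       EGm_sequence G \<beta> \<gamma> \<tau>1 \<tau>2 x \<and> (\<forall>k\<ge>1. G (extrapolate \<gamma> x k) \<noteq> 0) \<longrightarrow>
       (\<forall>k. x k \<in> ball xbar r) \<and>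
       (\<forall>k\<ge>1. extrapolate \<beta> x k \<in> ball xbar r \<and> extrapolate \<gamma> x k \<in> ball xbar r) \<and>
       (\<exists>xt\<in>ball xbar r.
          local_minimizer_on X f xt \<and> f xt = f xbar \<and>
          x \<longlonglongrightarrow> xt \<and> extrapolate \<beta> x \<longlonglongrightarrow> xt \<and> extrapolate \<gamma> x \<longlonglongrightarrow> xt \<and>
          (\<forall>M q. 0 < M \<and> 0 < q \<and> q < 1 \<and>
             (\<forall>t. 0 \<le> t \<and> ereal t < \<eta> \<longrightarrow> \<psi> t = M * t powr (1 - q)) \<longrightarrow>
             (q = 1/2 \<longrightarrow>
                converges_linearly x xt \<and>
                converges_linearly (\<lambda>k. G (x k)) 0 \<and>
                converges_linearly (\<lambda>k. f (x k)) (f xt)) \<and>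
             (1/2 < q \<longrightarrow>
                (\<lambda>k. norm (x k - xt)) \<in> O(\<lambda>k. real k powr (- ((1 - q) / (2 * q - 1)))) \<and>
                (\<lambda>k. norm (G (x k))) \<in> O(\<lambda>k. real k powr (- ((1 - q) / (2 * q - 1)))) \<and>
                (\<lambda>k. f (x k) - f xt) \<in> O(\<lambda>k. real k powr (- ((2 - 2 * q) / (2 * q - 1))))))))"
proof -
  define B where "B = (SUP k\<in>{1..}. \<beta> k)"
  define C where "C = B + (SUP k\<in>{1..}. \<bar>\<beta> k - \<gamma> k\<bar>)"
  have \<beta>B: "\<beta> k \<le> B" if "k \<ge> 1" for k
    unfolding B_def using assms(13) that by (intro cSUP_upper) auto
  have dev: "\<bar>\<beta> k - \<gamma> k\<bar> \<le> (SUP k\<in>{1..}. \<bar>\<beta> k - \<gamma> k\<bar>)" if "k \<ge> 1" for k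
    using assms(15) that by (intro cSUP_upper) auto
  have \<gamma>C: "\<gamma> k \<le> C" if "k \<ge> 1" for k
    using \<beta>B[OF that] dev[OF that] by (simp add: C_def)
  have B0: "0 \<le> B" using \<beta>B[of 1] assms(11) by force
  have BC: "B \<le> C" using dev[of 1] by (simp add: C_def)
  have "B\<^sup>2 < (sqrt (1 - \<nu>))\<^sup>2"
    using assms(14) B0 unfolding B_def[symmetric] by (intro power_strict_mono) auto
  then have B2: "B\<^sup>2 < 1 - \<nu>" using assms(10) by simp
  \<comment> \<open>Both \<open>\<epsilon>\<close> and the stepsize bound \<open>T\<close> depend
    only on \<open>L\<close>, \<open>\<nu>\<close> and the two suprema, not on the starting
    point.\<close>
  define \<epsilon> where "\<epsilon> = (1 - \<nu> - B\<^sup>2) / 8"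
  have \<epsilon>: "0 < \<epsilon>" "8 * \<epsilon> \<le> 1 - \<nu> - B\<^sup>2" using B2 by (auto simp: \<epsilon>_def)
  define T where "T = min 1 (\<epsilon> / (L * (1 + C)))"
  have LC: "0 < L * (1 + C)" using assms(5) B0 BC by simp
  have T: "0 < T" using \<epsilon> LC by (simp add: T_def)

  obtain U where U: "xbar \<in> interior U" "U \<subseteq> X"
    and plkU: "\<And>y. y \<in> U \<Longrightarrow> f xbar < f y \<Longrightarrow> ereal (f y) < ereal (f xbar) + \<eta> \<Longrightarrow>
      1 \<le> deriv \<psi> (f y - f xbar) * norm (G y)"
    and des: "desingularizing \<eta> \<psi>"
    using assms(8) unfolding PLK_condition_def by blast
  obtain e1 where e1: "e1 > 0" "ball xbar e1 \<subseteq> U" using U(1) by (auto simp: mem_interior)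
  obtain e2 where e2: "e2 > 0" "\<And>y. y \<in> X \<inter> ball xbar e2 \<Longrightarrow> f xbar \<le> f y"
    using assms(7) unfolding local_minimizer_on_def by blast
  define \<rho> where "\<rho> = min r (min e1 e2)"
  have \<rho>: "0 < \<rho>" "\<rho> \<le> r" using assms(1) e1 e2 by (auto simp: \<rho>_def)
  have \<rho>r: "ball xbar \<rho> \<subseteq> ball xbar r" using \<rho> by auto
  have \<rho>X: "ball xbar \<rho> \<subseteq> X" using \<rho>r assms(2) by simp
  have \<rho>U: "ball xbar \<rho> \<subseteq> U" using e1 by (auto simp: \<rho>_def)
  have \<rho>min: "f xbar \<le> f y" if "y \<in> ball xbar \<rho>" for y
    using e2(2)[of y] that \<rho>X by (auto simp: \<rho>_def)
  \<comment> \<open>A real bound replaces the extended one; it can be 1 if \<open>\<eta>\<close> is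
    infinite. This suffices because the energy of a run never exceeds its small initial
    value.\<close>
  obtain \<zeta> :: real where \<zeta>: "0 < \<zeta>" "ereal \<zeta> \<le> \<eta>"
    using des by (cases \<eta>) (auto simp: desingularizing_def intro: that[of 1])
  have less_eta: "ereal t < \<eta>" if "t < \<zeta>" for t
    using that \<zeta>(2) by (auto intro: less_le_trans[of _ "ereal \<zeta>"])
  obtain \<phi> where \<phi>: "\<phi> 0 = 0"
    "\<And>t. 0 \<le> t \<Longrightarrow> ereal t < \<eta> \<Longrightarrow> \<phi> t \<le> \<psi> t"
    "\<And>s u. 0 < s \<Longrightarrow> ereal s < \<eta> \<Longrightarrow> 0 \<le> u \<Longrightarrow> ereal u < \<eta>
          \<Longrightarrow> \<phi> u \<le> \<phi> s + deriv \<psi> s * (u - s)"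
    "\<And>e. 0 < e \<Longrightarrow> \<exists>\<delta>>0. \<forall>t. 0 \<le> t \<and> t < \<delta> \<longrightarrow> \<phi> t < e"
    using desingularizing_remove_jump[OF des] by metis

  interpret P: plk_ball \<phi> "deriv \<psi>" \<zeta> f G xbar \<rho> L
  proof
    fix s u :: real assume "0 < s" "s < \<zeta>" "0 \<le> u" "u < \<zeta>"
    then show "\<phi> u \<le> \<phi> s + deriv \<psi> s * (u - s)" using \<phi>(3) less_eta by blast
  next
    fix s :: real assume "0 < s" "s < \<zeta>"
    then show "0 < deriv \<psi> s" using des less_eta unfolding desingularizing_def by blast
  next
    fix y assume y: "y \<in> ball xbar \<rho>" "f xbar < f y" "f y < f xbar + \<zeta>"
    have "ereal (f y) < ereal (f xbar) + ereal \<zeta>" using y by simp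
    also have "\<dots> \<le> ereal (f xbar) + \<eta>" using \<zeta> by (intro add_left_mono)
    finally show "1 \<le> deriv \<psi> (f y - f xbar) * norm (G y)" using plkU y \<rho>U by blast
  next
    show "\<forall>x\<in>ball xbar \<rho>. \<forall>y\<in>ball xbar \<rho>. norm (G x - G y) \<le> L * norm (x - y)"
      using assms(6) \<rho>X by blast
  qed (use \<phi>(1) \<rho> assms(3,5) \<rho>X \<rho>min in auto)

  \<comment> \<open>This value solves \<open>24 / \<epsilon> * e * (1 + C) = \<rho> / 8\<close>, the
    length budget of a run.\<close>
  define e where "e = \<rho> / 8 * \<epsilon> / (24 * (1 + C))"
  have e: "0 < e" using \<rho> \<epsilon> B0 BC by (simp add: e_def)
  obtain \<xi> where \<xi>: "0 < \<xi>" "\<xi> \<le> \<rho> / 8"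
    "\<And>y. y \<in> ball xbar \<xi> \<Longrightarrow> f y - f xbar < \<zeta> \<and> sqrt_regularization \<phi> (f y - f xbar) \<le> e"
    using P.start_radius[OF e \<zeta>(1) \<phi>(4)[OF half_gt_zero[OF e]]] by blast

  show ?thesis
  proof (rule exI[of _ \<xi>], rule exI[of _ T], intro conjI allI impI; (elim conjE)?)
    show "0 < \<xi>" "\<xi> \<le> r" "0 < T" using \<xi> \<rho> T by auto
  next
    fix x :: "nat \<Rightarrow> real ^ 'n" and \<tau>1 \<tau>2
    assume x0: "x 0 \<in> ball xbar \<xi>" and \<tau>1: "0 < \<tau>1" "\<tau>1 \<le> T"
      and \<tau>2: "0 \<le> \<tau>2" "\<tau>2 \<le> \<nu> / (L * (\<nu> + 1))" and egm: "EGm_sequence G \<beta> \<gamma> \<tau>1 \<tau>2 x"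
    have x1: "x 1 \<in> ball xbar \<xi>" using x0 egm by (simp add: EGm_sequence_def)
    interpret R: egm_run \<phi> "deriv \<psi>" \<zeta> f G xbar \<rho> L \<nu> B C \<epsilon> \<tau>1 \<tau>2 \<beta> \<gamma> x
    proof
      show "\<tau>1 \<le> 1" using \<tau>1 by (simp add: T_def)
      have "\<tau>1 \<le> \<epsilon> / (L * (1 + C))" using \<tau>1 by (simp add: T_def)
      then show "\<tau>1 * (L * (1 + C)) \<le> \<epsilon>" by (simp only: pos_le_divide_eq[OF LC])
      show "x 1 \<in> ball xbar (\<rho> / 8)" using x1 \<xi>(2) by auto
      show "f (x 1) - f xbar < \<zeta>" using \<xi>(3)[OF x1] by simp
      have "24 / \<epsilon> * sqrt_regularization \<phi> (f (x 1) - f xbar) * (1 + C) \<le> 24 / \<epsilon> * e * (1 + C)"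
        using \<xi>(3)[OF x1] \<epsilon> B0 BC by (intro mult_right_mono mult_left_mono) auto
      also have "\<dots> = \<rho> / 8"
      proof -
        have "24 / \<epsilon> * (\<rho> / 8 * \<epsilon> / (24 * a)) * a = \<rho> / 8" if "a \<noteq> 0" for a
          using that \<epsilon> by simp
        from this[of "1 + C"] show ?thesis unfolding e_def using B0 BC by simp
      qed
      finally show "24 / \<epsilon> * sqrt_regularization \<phi> (f (x 1) - f xbar) * (1 + C) \<le> \<rho> / 8" .
    qed (use assms(9-12) \<epsilon> \<tau>1 \<tau>2 egm B0 BC \<beta>B \<gamma>C in auto)

    have minimizer: "local_minimizer_on X f R.xt"
      unfolding local_minimizer_on_def
    \<comment> \<open>In the ball where \<open>xbar\<close> is minimal, any point with the same
      value is a local minimizer; the radius is chosen so that the ball around the limit stays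
      inside.\<close>
    proof (intro conjI exI[of _ "\<rho> - dist xbar R.xt"] ballI)
      show "R.xt \<in> X" using R.xt_ball \<rho>X by blast
      show "0 < \<rho> - dist xbar R.xt" using R.xt_ball by simp
      fix y assume "y \<in> X \<inter> ball R.xt (\<rho> - dist xbar R.xt)"
      then have "y \<in> ball xbar \<rho>" using dist_triangle[of xbar y R.xt] by simp
      then show "f R.xt \<le> f y" using \<rho>min R.f_lim by simp
    qed

    have rates: "(q = 1/2 \<longrightarrow> converges_linearly x R.xt \<and>
                converges_linearly (\<lambda>k. G (x k)) 0 \<and>
                converges_linearly (\<lambda>k. f (x k)) (f R.xt)) \<and>
             (1/2 < q \<longrightarrow>
                (\<lambda>k. norm (x k - R.xt)) \<in> O(\<lambda>k. real k powr (- ((1 - q) / (2 * q - 1)))) \<and>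
                (\<lambda>k. norm (G (x k))) \<in> O(\<lambda>k. real k powr (- ((1 - q) / (2 * q - 1)))) \<and>
                (\<lambda>k. f (x k) - f R.xt) \<in> O(\<lambda>k. real k powr (- ((2 - 2 * q) / (2 * q - 1)))))"
      if M: "0 < M" and q: "0 < q" "q < 1"
        and \<psi>_eq: "\<forall>t. 0 \<le> t \<and> ereal t < \<eta> \<longrightarrow> \<psi> t = M * t powr (1 - q)" for M q :: real
    proof -
      have phi_power: "\<phi> s \<le> M * s powr (1 - q)" if "0 \<le> s" "s < \<zeta>" for s
        using \<phi>(2)[of s] \<psi>_eq that less_eta[of s] by simp
      \<comment> \<open>The slope \<open>M (1 - q) s^(-q)\<close> is that of \<open>\<psi>\<close>
        itself, so the factor \<open>s^q\<close> cancels to the constant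
        \<open>A = M (1 - q)\<close>.\<close>
      have slope_power: "deriv \<psi> s * s powr q \<le> M * (1 - q)" if s: "0 < s" "s < \<zeta>" for s
      proof -
        have "((\<lambda>t. M * t powr (1 - q)) has_real_derivative M * ((1 - q) * s powr (1 - q - 1))) (at s)"
          using s by (auto intro!: derivative_eq_intros)
        then have "(\<psi> has_real_derivative M * ((1 - q) * s powr (1 - q - 1))) (at s)"
          by (rule has_field_derivative_transform_within_open[of _ _ _ "{0<..<\<zeta>}"])
            (use s \<psi>_eq less_eta in auto)
        then have "deriv \<psi> s = M * ((1 - q) * s powr (- q))" by (simp add: DERIV_imp_deriv)
        then have "deriv \<psi> s * s powr q = M * (1 - q) * (s powr (- q) * s powr q)" by simp
        also have "s powr (- q) * s powr q = 1" using s by (simp flip: powr_add)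
        finally show ?thesis by simp
      qed
      have A: "0 < M * (1 - q)" using M q by simp
      show ?thesis
      proof (intro conjI impI)
        assume half: "q = 1 / 2"
        obtain \<mu> where \<mu>: "0 < \<mu>" "\<mu> < 1" and dist: "(\<lambda>k. norm (x k - R.xt)) \<in> O(\<lambda>k. \<mu> ^ k)"
          using R.linear_rate[OF M A _ q(2) phi_power slope_power half] half by auto
        show "converges_linearly x R.xt"
          using \<mu> dist unfolding converges_linearly_def by blast
        show "converges_linearly (\<lambda>k. G (x k)) 0"
          using \<mu> R.gradient_rate[OF dist] unfolding converges_linearly_def by auto
        have "(\<lambda>k. norm (f (x k) - f R.xt)) \<in> O(\<lambda>k. (\<mu>\<^sup>2) ^ k)"
          using R.value_rate[OF dist] by (simp add: power_mult[symmetric] mult.commute)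
        moreover have "0 < \<mu>\<^sup>2" "\<mu>\<^sup>2 < 1" using \<mu> by (auto simp: power_less_one_iff)
        ultimately show "converges_linearly (\<lambda>k. f (x k)) (f R.xt)"
          unfolding converges_linearly_def by blast
      next
        assume half: "1 / 2 < q"
        note dist = R.sublinear_rate[OF M A less_imp_le[OF half] q(2) phi_power slope_power half]
        show "(\<lambda>k. norm (x k - R.xt)) \<in> O(\<lambda>k. real k powr (- ((1 - q) / (2 * q - 1))))"
          by (rule dist)
        show "(\<lambda>k. norm (G (x k))) \<in> O(\<lambda>k. real k powr (- ((1 - q) / (2 * q - 1))))"
          by (rule R.gradient_rate[OF dist])
        have "(real k powr (- ((1 - q) / (2 * q - 1))))\<^sup>2 = real k powr (- ((2 - 2 * q) / (2 * q - 1)))" for k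
          by (simp add: power2_eq_square diff_divide_distrib flip: powr_add)
        then show "(\<lambda>k. f (x k) - f R.xt) \<in> O(\<lambda>k. real k powr (- ((2 - 2 * q) / (2 * q - 1))))"
          using R.value_rate[OF dist] by simp
      qed
    qed

    show "x k \<in> ball xbar r" for k using R.in_ball \<rho>r by blast
    show "extrapolate \<beta> x k \<in> ball xbar r" "extrapolate \<gamma> x k \<in> ball xbar r" if "1 \<le> k" for k
      using R.extrapolate_in_ball[OF that] \<rho>r by auto
    have "extrapolate \<beta> x \<longlonglongrightarrow> R.xt" "extrapolate \<gamma> x \<longlonglongrightarrow> R.xt"
      using R.beta R.gamma BC by (intro R.extrapolate_lim; force)+
    then show "\<exists>xt\<in>ball xbar r.
          local_minimizer_on X f xt \<and> f xt = f xbar \<and>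
          x \<longlonglongrightarrow> xt \<and> extrapolate \<beta> x \<longlonglongrightarrow> xt \<and> extrapolate \<gamma> x \<longlonglongrightarrow> xt \<and>
          (\<forall>M q. 0 < M \<and> 0 < q \<and> q < 1 \<and>
             (\<forall>t. 0 \<le> t \<and> ereal t < \<eta> \<longrightarrow> \<psi> t = M * t powr (1 - q)) \<longrightarrow>
             (q = 1/2 \<longrightarrow>
                converges_linearly x xt \<and>
                converges_linearly (\<lambda>k. G (x k)) 0 \<and>
                converges_linearly (\<lambda>k. f (x k)) (f xt)) \<and>
             (1/2 < q \<longrightarrow>
                (\<lambda>k. norm (x k - xt)) \<in> O(\<lambda>k. real k powr (- ((1 - q) / (2 * q - 1)))) \<and>
                (\<lambda>k. norm (G (x k))) \<in> O(\<lambda>k. real k powr (- ((1 - q) / (2 * q - 1)))) \<and>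
                (\<lambda>k. f (x k) - f xt) \<in> O(\<lambda>k. real k powr (- ((2 - 2 * q) / (2 * q - 1))))))"
      using minimizer R.f_lim R.x_lim R.xt_ball \<rho>r rates by (intro bexI[of _ R.xt]) blast+
  qed
qed

end
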